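(* Let $n\ge1$. The Lie subgroup $\mathbb{A}(n)$ of $\mathrm{PSU}(n+1)$ satisfies the following properties. (1) $\mathbb{A}(n)$ is isomorphic to $\mathbb{T}^n$. (2) $\mathbb{A}(n)$ is a maximal Abelian subgroup of $\mathrm{PSU}(n+1)$; i.e. if $H$ is a connected Abelian proper subgroup of $\mathrm{PSU}(n+1)$ that contains $\mathbb{A}(n)$, then $H=\mathbb{A}(n)$. (3) If $H$ is a connected Abelian Lie subgroup of $\mathrm{PSU}(n+1)$, then there exists $g\in\mathrm{PSU}(n+1)$ such that $gHg^{-1}\subset\mathbb{A}(n)$.
   Context: $\mathbb{T}=\{t\in\mathbb{C}:|t|=1\}$. $\mathrm{SU}(n+1)$ is the group of $(n+1)\times(n+1)$ unitary matrices of determinant $1$; $\mathrm{PSU}(n+1)=\mathrm{SU}(n+1)/\{\zeta I:\zeta^{n+1}=1\}$, with quotient map $\lambda$. $\mathbb{A}(n)=\lambda(\widehat{\mathbb{A}}(n))$, where $\widehat{\mathbb{A}}(n)$ is the subgroup of diagonal matrices in $\mathrm{SU}(n+1)$. *)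

theory Defs
  imports "HOL-Analysis.Analysis" "HOL-Algebra.Coset"
begin

definition adjoint_matrix :: "complex^'n^'n \<Rightarrow> complex^'n^'n" where
  "adjoint_matrix A = (\<chi> i j. cnj (A $ j $ i))"

definition unitary_matrix :: "complex^'n^'n \<Rightarrow> bool" where
  "unitary_matrix A \<longleftrightarrow> A ** adjoint_matrix A = mat 1 \<and> adjoint_matrix A ** A = mat 1"

text \<open>The size of the matrices is the cardinality of the index type: for
  \<open>CARD('n) = n + 1\<close> the following groups are \<open>SU(n+1)\<close> and \<open>PSU(n+1)\<close>.\<close>

definition SU :: "(complex^'n^'n) monoid" where
  "SU = \<lparr>carrier = {A. unitary_matrix A \<and> det A = 1}, mult = (**), one = mat 1\<rparr>"

definition SU_scalars :: "(complex^'n^'n) set" where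
  "SU_scalars = {mat \<zeta> |\<zeta>. \<zeta> ^ CARD('n) = 1}"

definition PSU :: "(complex^'n^'n) set monoid" where
  "PSU = SU Mod SU_scalars"

definition PSU_proj :: "complex^'n^'n \<Rightarrow> (complex^'n^'n) set" where
  "PSU_proj A = SU_scalars #>\<^bsub>SU\<^esub> A"

definition SU_diagonal :: "(complex^'n^'n) set" where
  "SU_diagonal = {A \<in> carrier SU. \<forall>i j. i \<noteq> j \<longrightarrow> A $ i $ j = 0}"

definition PSU_diagonal :: "(complex^'n^'n) set set" where
  "PSU_diagonal = PSU_proj ` SU_diagonal"

definition torus :: "(complex^'m) monoid" where
  "torus = \<lparr>carrier = {z. \<forall>i. norm (z $ i) = 1},
            mult = (\<lambda>z w. \<chi> i. z $ i * w $ i), one = (\<chi> i. 1)\<rparr>"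

definition PSU_topology :: "(complex^'n^'n) set topology" where
  "PSU_topology = topology (\<lambda>X. X \<subseteq> carrier PSU \<and>
     openin (top_of_set (carrier SU)) {A \<in> carrier SU. PSU_proj A \<in> X})"

lemma openin_PSU_topology:
  fixes X :: "(complex^'n^'n) set set"
  shows "openin PSU_topology X \<longleftrightarrow> X \<subseteq> carrier PSU \<and>
     openin (top_of_set (carrier SU)) {A \<in> carrier SU. PSU_proj A \<in> X}"
proof -
  let ?pre = "\<lambda>S :: (complex^'n^'n) set set. {A \<in> carrier SU. PSU_proj A \<in> S}"
  let ?L = "\<lambda>S. S \<subseteq> carrier PSU \<and> openin (top_of_set (carrier SU)) (?pre S)"
  have int: "?L (S \<inter> T)" if "?L S" "?L T" for S T
  proof -
    have "?pre (S \<inter> T) = ?pre S \<inter> ?pre T"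
      by blast
    moreover have "openin (top_of_set (carrier SU)) (?pre S \<inter> ?pre T)"
      by (rule openin_Int) (use that in blast)+
    ultimately show ?thesis
      using that(1) by auto
  qed
  have union: "?L (\<Union>K)" if "\<forall>S\<in>K. ?L S" for K
  proof -
    have "?pre (\<Union>K) = \<Union> (?pre ` K)"
      by blast
    moreover have "openin (top_of_set (carrier SU)) (\<Union> (?pre ` K))"
      by (rule openin_Union) (use that in blast)
    ultimately show ?thesis
      using that by auto
  qed
  have "istopology ?L"
    unfolding istopology_def using int union by blast
  then show ?thesis
    unfolding PSU_topology_def by (subst topology_inverse') auto
qed

text \<open>\<open>C_k k f W\<close> is only meant for open \<open>W\<close>. Smoothness is over the reals, also
  for maps between complex vector spaces.\<close>

primrec C_k :: "nat \<Rightarrow> ('a::real_normed_vector \<Rightarrow> 'b::real_normed_vector) \<Rightarrow> 'a set \<Rightarrow> bool" where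
  "C_k 0 f W \<longleftrightarrow> continuous_on W f"
| "C_k (Suc k) f W \<longleftrightarrow> (\<forall>x\<in>W. f differentiable (at x)) \<and>
     (\<forall>v. C_k k (\<lambda>x. frechet_derivative f (at x) v) W)"

definition C_infinity :: "('a::real_normed_vector \<Rightarrow> 'b::real_normed_vector) \<Rightarrow> 'a set \<Rightarrow> bool" where
  "C_infinity f W \<longleftrightarrow> (\<forall>k. C_k k f W)"

text \<open>On an arbitrary set, in particular on an embedded submanifold such as \<open>carrier SU\<close>
  or \<open>carrier torus\<close>, smooth means locally extendable to a smooth map on an open set.\<close>

definition smooth_map_on :: "'a::real_normed_vector set \<Rightarrow> ('a \<Rightarrow> 'b::real_normed_vector) \<Rightarrow> bool" where
  "smooth_map_on S f \<longleftrightarrow>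
     (\<forall>x\<in>S. \<exists>W F. open W \<and> x \<in> W \<and> C_infinity F W \<and> (\<forall>y\<in>S \<inter> W. f y = F y))"

text \<open>\<open>PSU\<close> carries the smooth structure of the quotient of \<open>SU\<close> by a finite central
  subgroup, so that \<open>PSU_proj\<close> is a smooth covering. Hence smoothness of a map into \<open>PSU\<close>
  means that it locally lifts to a smooth map into \<open>SU\<close>, and a map defined on \<open>X \<subseteq> PSU\<close> is
  smooth iff its composition with \<open>PSU_proj\<close> is.\<close>

definition smooth_lift_at ::
    "'a::real_normed_vector set \<Rightarrow> ('a \<Rightarrow> (complex^'n^'n) set) \<Rightarrow> 'a \<Rightarrow> ('a \<Rightarrow> complex^'n^'n) \<Rightarrow> bool" where
  "smooth_lift_at S g x F \<longleftrightarrow> (\<exists>W. open W \<and> x \<in> W \<and> C_infinity F W \<and>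
     (\<forall>y\<in>S \<inter> W. F y \<in> carrier SU \<and> g y = PSU_proj (F y)))"

definition smooth_into_PSU ::
    "'a::real_normed_vector set \<Rightarrow> ('a \<Rightarrow> (complex^'n^'n) set) \<Rightarrow> bool" where
  "smooth_into_PSU S g \<longleftrightarrow> (\<forall>x\<in>S. \<exists>F. smooth_lift_at S g x F)"

definition smooth_from_PSU ::
    "(complex^'n^'n) set set \<Rightarrow> ((complex^'n^'n) set \<Rightarrow> 'b::real_normed_vector) \<Rightarrow> bool" where
  "smooth_from_PSU X f \<longleftrightarrow>
     smooth_map_on {A \<in> carrier SU. PSU_proj A \<in> X} (\<lambda>A. f (PSU_proj A))"

text \<open>For a map defined on an open subset \<open>U\<close> of a linear space \<open>V\<close>: since \<open>PSU_proj\<close> is a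
  local diffeomorphism, injectivity of the derivative can be tested on a local lift. The
  derivative of the lift along \<open>V\<close> does not depend on its extension to an open set.\<close>

definition immersion_into_PSU ::
    "'a::real_normed_vector set \<Rightarrow> 'a set \<Rightarrow> ('a \<Rightarrow> (complex^'n^'n) set) \<Rightarrow> bool" where
  "immersion_into_PSU V U \<psi> \<longleftrightarrow>
     (\<forall>x\<in>U. \<exists>F. smooth_lift_at U \<psi> x F \<and> inj_on (frechet_derivative F (at x)) V)"

text \<open>A Lie subgroup of \<open>PSU\<close> is a subgroup \<open>H\<close> with a topology \<open>T\<close> and a smooth structure for
  which it is a Lie group and an immersed submanifold of \<open>PSU\<close>; \<open>T\<close> may be finer than the
  subspace topology. The smooth structure is given by a set \<open>P\<close> of local parametrizations,
  i.e. pairs \<open>(U, \<psi>)\<close> where \<open>\<psi>\<close> is the inverse of a chart and \<open>U\<close> is its image. In the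
  role of the model space \<open>\<real>\<^sup>k\<close> there is a real linear subspace \<open>V\<close> of the space of matrices;
  this loses no generality because the dimension of an immersed submanifold is at most that
  of \<open>PSU\<close>.\<close>

type_synonym 'n param = "(complex^'n^'n) set \<times> (complex^'n^'n \<Rightarrow> (complex^'n^'n) set)"

definition immersed_submanifold ::
    "(complex^'n^'n) set topology \<Rightarrow> (complex^'n^'n) set \<Rightarrow> 'n param set \<Rightarrow> bool" where
  "immersed_submanifold T V P \<longleftrightarrow>
     Hausdorff_space T \<and> second_countable T \<and> subspace V \<and>
     topspace T = (\<Union>(U, \<psi>)\<in>P. \<psi> ` U) \<and>
     (\<forall>(U, \<psi>)\<in>P. openin (top_of_set V) U \<and> openin T (\<psi> ` U) \<and>
        homeomorphic_map (top_of_set U) (subtopology T (\<psi> ` U)) \<psi> \<and>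
        immersion_into_PSU V U \<psi>) \<and>
     (\<forall>(U, \<psi>)\<in>P. \<forall>(U', \<psi>')\<in>P.
        smooth_map_on {x \<in> U. \<psi> x \<in> \<psi>' ` U'} (\<lambda>x. inv_into U' \<psi>' (\<psi> x)))"

definition smooth_group_operations ::
    "(complex^'n^'n) set topology \<Rightarrow> 'n param set \<Rightarrow> bool" where
  "smooth_group_operations T P \<longleftrightarrow>
     continuous_map (prod_topology T T) T (\<lambda>(a, b). a \<otimes>\<^bsub>PSU\<^esub> b) \<and>
     continuous_map T T (\<lambda>a. inv\<^bsub>PSU\<^esub> a) \<and>
     (\<forall>(U1, \<psi>1)\<in>P. \<forall>(U2, \<psi>2)\<in>P. \<forall>(U3, \<psi>3)\<in>P.
        smooth_map_on {(x, y) \<in> U1 \<times> U2. \<psi>1 x \<otimes>\<^bsub>PSU\<^esub> \<psi>2 y \<in> \<psi>3 ` U3}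
          (\<lambda>(x, y). inv_into U3 \<psi>3 (\<psi>1 x \<otimes>\<^bsub>PSU\<^esub> \<psi>2 y))) \<and>
     (\<forall>(U1, \<psi>1)\<in>P. \<forall>(U2, \<psi>2)\<in>P.
        smooth_map_on {x \<in> U1. inv\<^bsub>PSU\<^esub> (\<psi>1 x) \<in> \<psi>2 ` U2}
          (\<lambda>x. inv_into U2 \<psi>2 (inv\<^bsub>PSU\<^esub> (\<psi>1 x))))"

definition Lie_subgroup ::
    "(complex^'n^'n) set set \<Rightarrow> (complex^'n^'n) set topology \<Rightarrow> bool" where
  "Lie_subgroup H T \<longleftrightarrow> subgroup H PSU \<and> topspace T = H \<and>
     (\<exists>V P. immersed_submanifold T V P \<and> smooth_group_operations T P)"

definition abelian_subgroup :: "(complex^'n^'n) set set \<Rightarrow> bool" where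
  "abelian_subgroup H \<longleftrightarrow> subgroup H PSU \<and> comm_group (PSU\<lparr>carrier := H\<rparr>)"

text \<open>Isomorphism of Lie groups between a subgroup \<open>H\<close> of \<open>PSU\<close> that is a Lie subgroup with
  the subspace topology, hence an embedded submanifold, and the torus whose dimension is
  the cardinality of the type \<open>'m\<close>.\<close>

definition Lie_isomorphism_to_torus ::
    "(complex^'n^'n) set set \<Rightarrow> ((complex^'n^'n) set \<Rightarrow> complex^'m) \<Rightarrow> bool" where
  "Lie_isomorphism_to_torus H \<phi> \<longleftrightarrow>
     \<phi> \<in> iso (PSU\<lparr>carrier := H\<rparr>) torus \<and>
     smooth_from_PSU H \<phi> \<and> smooth_into_PSU (carrier torus) (inv_into H \<phi>)"

end

theory Submission
  imports Defs "HOL-Complex_Analysis.Cauchy_Integral_Formula"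
    "HOL-Computational_Algebra.Fundamental_Theorem_Algebra"
begin

text \<open>The ratios \<open>a\<^sub>i / a\<^sub>j\<close> of the diagonal entries of a unitary matrix are not changed by scalars,
  so they are continuous functions on \<open>PSU\<close>. On the compact diagonal subgroup they separate points
  and embed it into a linear space. Logarithms of the ratios give its charts, and the ratios to a
  fixed entry \<open>a\<^bsub>i\<^sub>0\<^esub>\<close> give the isomorphism with the torus.

  The diagonal subgroup is its own centraliser, which implies maximality.

  If \<open>H\<close> is connected and Abelian, the commutator of lifts of two elements of \<open>H\<close> is a root of unity
  times the identity. It depends continuously on one of the elements while the other is fixed, hence
  is constant, and it is trivial at the identity. So the lifts form a commuting family of unitary
  matrices, which has an orthonormal basis of common eigenvectors.\<close>

section \<open>Smooth maps\<close>

text \<open>Three points shape the proof. A lift from \<open>PSU\<close> to \<open>SU\<close> can be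
  chosen, but not continuously. So everything on \<open>PSU\<close> is expressed by functions of a
  lift in which a scalar of modulus one cancels: the ratios and the commutators. Compactness turns
  the ratio map on the diagonal subgroup into a homeomorphism onto its image, so Hausdorffness,
  countability and continuity are settled in a linear space. The charts of the diagonal subgroup
  share one domain, on which differences of angles are below pi/2. There the ratios, taken relative
  to the centre of the chart, lie in the right half-plane, where \<open>Ln\<close> is smooth, and
  two logarithms add up without leaving its strip. One formula thus inverts every chart, and
  transition maps, products and inverses are smooth for a single reason. A Lie subgroup is connected
  in its own topology, which may be finer than that of \<open>PSU\<close>. Local lifts of its charts
  show that the inclusion into \<open>PSU\<close> is continuous, and only then does the argument
  with commutators apply.\<close>

lemma C_k_SucD:
  assumes "C_k (Suc k) f W" "x \<in> W"
  shows "(f has_derivative frechet_derivative f (at x)) (at x)"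
  using assms by (simp add: frechet_derivative_works[symmetric])

text \<open>On an open \<open>W\<close>, agreement of \<open>f\<close> and \<open>g\<close> makes
  their derivatives agree as well, so the induction carries over to the derivatives.\<close>

lemma C_k_cong:
  assumes "open W" "\<And>x. x \<in> W \<Longrightarrow> f x = g x"
  shows "C_k k f W \<longleftrightarrow> C_k k g W"
  using assms(2)
proof (induction k arbitrary: f g)
  case 0
  then show ?case by (simp cong: continuous_on_cong)
next
  case (Suc k)
  have imp: "C_k (Suc k) g W" if f: "C_k (Suc k) f W" and eq: "\<And>x. x \<in> W \<Longrightarrow> f x = g x" for f g :: "'a \<Rightarrow> 'b"
  proof -
    have d: "f differentiable (at x)" if "x \<in> W" for x
      using f that by simp
    have fr: "frechet_derivative f (at x) = frechet_derivative g (at x)" if "x \<in> W" for x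
      using frechet_derivative_transform_within_open[OF d[OF that] assms(1) that] eq by blast
    have "g differentiable (at x)" if "x \<in> W" for x
      using has_derivative_transform_within_open[OF C_k_SucD[OF f that] assms(1) that eq]
      by (auto simp: differentiable_def)
    moreover have "C_k k (\<lambda>x. frechet_derivative g (at x) v) W" for v
      using f Suc.IH[of "\<lambda>x. frechet_derivative f (at x) v" "\<lambda>x. frechet_derivative g (at x) v"] fr
      by simp
    ultimately show ?thesis by simp
  qed
  from imp[of f g] imp[of g f] Suc.prems show ?case by metis
qed

text \<open>Uniqueness of the derivative replaces \<open>frechet_derivative\<close> by an explicit
  formula \<open>f'\<close>. Most closure properties below are inductions through this rule.\<close>

lemma C_k_SucI:
  assumes "open W" "\<And>x. x \<in> W \<Longrightarrow> (f has_derivative f' x) (at x)"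
    and "\<And>v. C_k k (\<lambda>x. f' x v) W"
  shows "C_k (Suc k) f W"
proof -
  have "frechet_derivative f (at x) = f' x" if "x \<in> W" for x
    using frechet_derivative_at[OF assms(2)[OF that]] by simp
  then have "C_k k (\<lambda>x. frechet_derivative f (at x) v) W" for v
    using assms(3)[of v] C_k_cong[OF assms(1), of "\<lambda>x. frechet_derivative f (at x) v" "\<lambda>x. f' x v"]
    by simp
  then show ?thesis
    using assms(2) by (auto simp: differentiable_def)
qed

text \<open>In the product and chain rules undifferentiated factors occur as well, so those
  inductions have to lower the order of smoothness.\<close>

lemma C_k_SucE: "C_k (Suc k) f W \<Longrightarrow> open W \<Longrightarrow> C_k k f W"
proof (induction k arbitrary: f)
  case 0
  then show ?case
    by (auto simp: differentiable_imp_continuous_within intro!: continuous_at_imp_continuous_on)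
next
  case (Suc k)
  show ?case
    by (rule C_k_SucI[OF Suc.prems(2) C_k_SucD[OF Suc.prems(1)]]) (use Suc in simp_all)
qed

lemma C_k_subset: "C_k k f W \<Longrightarrow> V \<subseteq> W \<Longrightarrow> C_k k f V"
  by (induction k arbitrary: f) (auto intro: continuous_on_subset)

lemma C_k_const: "open W \<Longrightarrow> C_k k (\<lambda>x. c) W"
proof (induction k arbitrary: c)
  case (Suc k)
  show ?case
    by (rule C_k_SucI[where f' = "\<lambda>x v. 0"]) (use Suc in auto)
qed simp

lemma C_k_bounded_linear:
  assumes "bounded_linear L" "open W"
  shows "C_k k L W"
proof (cases k)
  case 0
  then show ?thesis using assms by (simp add: linear_continuous_on)
next
  case (Suc k)
  show ?thesis unfolding Suc
    by (rule C_k_SucI[where f' = "\<lambda>x. L"])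
      (use assms bounded_linear_imp_has_derivative C_k_const in auto)
qed

lemma C_k_bounded_linear_comp:
  assumes "bounded_linear L" "open W" "C_k k f W"
  shows "C_k k (\<lambda>x. L (f x)) W"
  using assms(3)
proof (induction k arbitrary: f)
  case 0
  then show ?case
    using bounded_linear.continuous_on[OF assms(1)] by simp
next
  case (Suc k)
  show ?case
    by (rule C_k_SucI[OF assms(2) bounded_linear.has_derivative[OF assms(1) C_k_SucD[OF Suc.prems]]])
      (use Suc in auto)
qed

lemma C_k_add: "open W \<Longrightarrow> C_k k f W \<Longrightarrow> C_k k g W \<Longrightarrow> C_k k (\<lambda>x. f x + g x) W"
proof (induction k arbitrary: f g)
  case 0
  then show ?case by (simp add: continuous_on_add)
next
  case (Suc k)
  show ?case
    by (rule C_k_SucI[OF Suc.prems(1)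
          has_derivative_add[OF C_k_SucD[OF Suc.prems(2)] C_k_SucD[OF Suc.prems(3)]]])
      (use Suc in auto)
qed

lemma C_k_mult:
  fixes f g :: "'a::real_normed_vector \<Rightarrow> complex"
  shows "open W \<Longrightarrow> C_k k f W \<Longrightarrow> C_k k g W \<Longrightarrow> C_k k (\<lambda>x. f x * g x) W"
proof (induction k arbitrary: f g)
  case 0
  then show ?case by (simp add: continuous_on_mult)
next
  case (Suc k)
  have "C_k k f W" "C_k k g W"
    using Suc.prems C_k_SucE by blast+
  then show ?case
    by (intro C_k_SucI[OF Suc.prems(1)
          has_derivative_mult[OF C_k_SucD[OF Suc.prems(2)] C_k_SucD[OF Suc.prems(3)]]])
      (use Suc in \<open>auto intro!: C_k_add Suc.IH\<close>)
qed

text \<open>Holomorphic outer functions form a class closed under \<open>deriv\<close>, so the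
  induction can put \<open>deriv g\<close> in place of \<open>g\<close> and needs only the
  first-order chain rule. This covers \<open>exp\<close> and \<open>Ln\<close>.\<close>

lemma C_k_holomorphic_comp:
  fixes f :: "'a::real_normed_vector \<Rightarrow> complex"
  assumes "open W" "open S" "g holomorphic_on S" "f ` W \<subseteq> S" "C_k k f W"
  shows "C_k k (\<lambda>x. g (f x)) W"
  using assms(3,5)
proof (induction k arbitrary: g)
  case 0
  then show ?case
    using continuous_on_compose2[of S g W f] holomorphic_on_imp_continuous_on assms(4) by simp
next
  case (Suc k)
  have "((\<lambda>x. g (f x)) has_derivative (\<lambda>v. deriv g (f x) * frechet_derivative f (at x) v)) (at x)"
    if "x \<in> W" for x
  proof -
    have "(g has_field_derivative deriv g (f x)) (at (f x))"
      using holomorphic_derivI[OF Suc.prems(1) assms(2)] assms(4) that by blast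
    then show ?thesis
      using has_derivative_compose[OF C_k_SucD[OF Suc.prems(2) that]]
      by (simp add: has_field_derivative_def)
  qed
  moreover have "C_k k (\<lambda>x. deriv g (f x) * frechet_derivative f (at x) v) W" for v
    by (rule C_k_mult[OF assms(1) Suc.IH[OF holomorphic_deriv[OF Suc.prems(1) assms(2)]
            C_k_SucE[OF Suc.prems(2) assms(1)]]]) (use Suc.prems(2) in simp)
  ultimately show ?case
    by (rule C_k_SucI[OF assms(1)])
qed

text \<open>Coordinate embeddings write a vector as a finite sum, which reduces smoothness and
  derivatives of vector-valued maps to those of the components.\<close>

lemma bounded_linear_axis: "bounded_linear (axis i :: 'b::real_normed_vector \<Rightarrow> 'b^'n)"
proof (rule bounded_linear_intro[where K = 1])
  show "norm (axis i x :: 'b^'n) \<le> norm x * 1" for x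
    by (simp add: norm_vec_def axis_def L2_set_def if_distrib[of norm] if_distrib[of "\<lambda>z. z\<^sup>2"] cong: if_cong)
qed (auto simp: axis_def vec_eq_iff)

lemma C_infinity_subset: "C_infinity f W \<Longrightarrow> V \<subseteq> W \<Longrightarrow> C_infinity f V"
  unfolding C_infinity_def using C_k_subset by blast

lemma C_infinity_const: "open W \<Longrightarrow> C_infinity (\<lambda>x. c) W"
  by (simp add: C_infinity_def C_k_const)

lemma C_infinity_bounded_linear: "bounded_linear L \<Longrightarrow> open W \<Longrightarrow> C_infinity L W"
  by (simp add: C_infinity_def C_k_bounded_linear)

lemma C_infinity_bounded_linear_comp:
  "bounded_linear L \<Longrightarrow> open W \<Longrightarrow> C_infinity f W \<Longrightarrow> C_infinity (\<lambda>x. L (f x)) W"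
  by (simp add: C_infinity_def C_k_bounded_linear_comp)

lemma C_infinity_add:
  "open W \<Longrightarrow> C_infinity f W \<Longrightarrow> C_infinity g W \<Longrightarrow> C_infinity (\<lambda>x. f x + g x) W"
  by (simp add: C_infinity_def C_k_add)

lemma C_infinity_sum:
  "open W \<Longrightarrow> (\<And>i. i \<in> I \<Longrightarrow> C_infinity (f i) W) \<Longrightarrow> C_infinity (\<lambda>x. \<Sum>i\<in>I. f i x) W"
  by (induction I rule: infinite_finite_induct) (auto intro!: C_infinity_const C_infinity_add)

lemma C_infinity_mult:
  fixes f g :: "'a::real_normed_vector \<Rightarrow> complex"
  shows "open W \<Longrightarrow> C_infinity f W \<Longrightarrow> C_infinity g W \<Longrightarrow> C_infinity (\<lambda>x. f x * g x) W"
  by (simp add: C_infinity_def C_k_mult)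

lemma C_infinity_prod:
  fixes f :: "'i \<Rightarrow> 'a::real_normed_vector \<Rightarrow> complex"
  shows "open W \<Longrightarrow> (\<And>i. i \<in> I \<Longrightarrow> C_infinity (f i) W) \<Longrightarrow> C_infinity (\<lambda>x. \<Prod>i\<in>I. f i x) W"
  by (induction I rule: infinite_finite_induct) (auto intro!: C_infinity_const C_infinity_mult)

lemma C_infinity_cnj: "open W \<Longrightarrow> C_infinity f W \<Longrightarrow> C_infinity (\<lambda>x. cnj (f x)) W"
  by (rule C_infinity_bounded_linear_comp[OF bounded_linear_cnj])

lemma C_infinity_holomorphic_comp:
  fixes f :: "'a::real_normed_vector \<Rightarrow> complex"
  assumes "open W" "open S" "g holomorphic_on S" "f ` W \<subseteq> S" "C_infinity f W"
  shows "C_infinity (\<lambda>x. g (f x)) W"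
  using assms C_k_holomorphic_comp unfolding C_infinity_def by blast

lemma C_infinity_exp:
  fixes f :: "'a::real_normed_vector \<Rightarrow> complex"
  shows "open W \<Longrightarrow> C_infinity f W \<Longrightarrow> C_infinity (\<lambda>x. exp (f x)) W"
  by (rule C_infinity_holomorphic_comp[of _ UNIV]) (auto intro: holomorphic_intros)

text \<open>The right half-plane avoids the branch cut of \<open>Ln\<close>. The neighbourhoods for
  charts and local sections below are cut out so that the arguments stay there.\<close>

lemma C_infinity_Ln:
  assumes "open W" "\<And>x. x \<in> W \<Longrightarrow> 0 < Re (f x)" "C_infinity f W"
  shows "C_infinity (\<lambda>x. Ln (f x)) W"
proof (rule C_infinity_holomorphic_comp[OF assms(1) _ _ _ assms(3)])
  show "open {z. 0 < Re z}"
    by (rule open_halfspace_Re_gt)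
  show "Ln holomorphic_on {z. 0 < Re z}"
    by (intro holomorphic_intros) (auto simp: complex_nonpos_Reals_iff)
qed (use assms in auto)

lemma C_infinity_vec:
  fixes f :: "'i::finite \<Rightarrow> 'a::real_normed_vector \<Rightarrow> 'b::real_normed_vector"
  assumes "open W" "\<And>i. C_infinity (f i) W"
  shows "C_infinity (\<lambda>x. \<chi> i. f i x) W"
proof -
  have "C_infinity (\<lambda>x. \<Sum>i\<in>UNIV. axis i (f i x)) W"
    by (intro C_infinity_sum C_infinity_bounded_linear_comp[OF bounded_linear_axis] assms)
  moreover have "(\<Sum>i\<in>UNIV. axis i (f i x)) = (\<chi> i. f i x)" for x
    by (simp add: vec_eq_iff axis_def if_distrib[of "\<lambda>z. z = _"] cong: if_cong)
  ultimately show ?thesis by simp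
qed

lemma C_infinity_imp_continuous_on: "C_infinity f W \<Longrightarrow> continuous_on W f"
  unfolding C_infinity_def by (metis C_k.simps(1))

section \<open>The groups \<open>SU\<close> and \<open>PSU\<close>\<close>

lemma adjoint_matrix_nth [simp]: "adjoint_matrix A $ i $ j = cnj (A $ j $ i)"
  by (simp add: adjoint_matrix_def)

lemma adjoint_adjoint_matrix [simp]: "adjoint_matrix (adjoint_matrix A) = A"
  by (simp add: vec_eq_iff)

lemma adjoint_matrix_mult: "adjoint_matrix (A ** B) = adjoint_matrix B ** adjoint_matrix A"
  by (simp add: vec_eq_iff matrix_matrix_mult_def mult.commute)

lemma adjoint_matrix_mat_1 [simp]: "adjoint_matrix (mat 1) = mat 1"
  by (simp add: vec_eq_iff mat_def)

lemma det_adjoint_matrix: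
  fixes A :: "complex^'n^'n"
  shows "det (adjoint_matrix A) = cnj (det A)"
proof -
  have "adjoint_matrix A = (\<chi> i j. cnj (transpose A $ i $ j))"
    by (simp add: vec_eq_iff transpose_def)
  moreover have "det (\<chi> i j. cnj (B $ i $ j)) = cnj (det B)" for B :: "complex^'n^'n"
    by (simp add: det_def)
  ultimately show ?thesis
    using det_transpose[of A] by simp
qed

lemma unitary_matrixD:
  assumes "unitary_matrix A"
  shows "A ** adjoint_matrix A = mat 1" "adjoint_matrix A ** A = mat 1"
  using assms by (simp_all add: unitary_matrix_def)

lemma unitary_matrix_mult:
  assumes "unitary_matrix A" "unitary_matrix B"
  shows "unitary_matrix (A ** B)"
proof -
  have "A ** B ** (adjoint_matrix B ** adjoint_matrix A) = A ** (B ** adjoint_matrix B) ** adjoint_matrix A"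
    "adjoint_matrix B ** adjoint_matrix A ** (A ** B) = adjoint_matrix B ** (adjoint_matrix A ** A) ** B"
    by (simp_all only: matrix_mul_assoc)
  then show ?thesis
    using assms by (simp add: unitary_matrix_def adjoint_matrix_mult)
qed

lemma unitary_matrix_adjoint: "unitary_matrix A \<Longrightarrow> unitary_matrix (adjoint_matrix A)"
  by (simp add: unitary_matrix_def)

lemma norm_det_unitary_matrix: "unitary_matrix A \<Longrightarrow> norm (det A) = 1"
proof -
  assume "unitary_matrix A"
  then have "det A * cnj (det A) = 1"
    by (metis unitary_matrixD(1) det_mul det_adjoint_matrix det_I)
  then have "(complex_of_real (norm (det A)))\<^sup>2 = 1"
    using complex_norm_square[of "det A"] by simp
  then have "(norm (det A))\<^sup>2 = 1"
    by (metis of_real_eq_1_iff of_real_power)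
  then show ?thesis
    by (simp add: power2_eq_1_iff) (use norm_ge_zero[of "det A"] in linarith)
qed

definition diag_matrix :: "('n \<Rightarrow> 'a::zero) \<Rightarrow> 'a^'n^'n" where
  "diag_matrix d = (\<chi> i j. if i = j then d i else 0)"

lemma diag_matrix_nth [simp]: "diag_matrix d $ i $ j = (if i = j then d i else 0)"
  by (simp add: diag_matrix_def)

lemma diag_matrix_mult_left: "(diag_matrix d ** A) $ i $ j = d i * (A $ i $ j :: 'a::semiring_1)"
  by (simp add: matrix_matrix_mult_def if_distrib[of "\<lambda>z. z * _"] cong: if_cong)

lemma diag_matrix_mult_right: "(A ** diag_matrix d) $ i $ j = (A $ i $ j :: 'a::semiring_1) * d j"
  by (simp add: matrix_matrix_mult_def if_distrib[of "\<lambda>z. _ * z"] cong: if_cong)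

lemma diag_matrix_mult:
  fixes a b :: "'n::finite \<Rightarrow> 'a::semiring_1"
  shows "diag_matrix a ** diag_matrix b = diag_matrix (\<lambda>i. a i * b i)"
  by (auto simp: vec_eq_iff diag_matrix_mult_left)

lemma adjoint_diag_matrix: "adjoint_matrix (diag_matrix a) = diag_matrix (\<lambda>i. cnj (a i))"
  by (simp add: vec_eq_iff)

lemma det_diag_matrix: "det (diag_matrix d :: 'a::comm_ring_1^'n^'n) = (\<Prod>i\<in>UNIV. d i)"
  by (subst det_diagonal) auto

text \<open>Brings scalar matrices under the entrywise rules for diagonal ones.\<close>

lemma mat_eq_diag_matrix: "mat c = diag_matrix (\<lambda>i. c)"
  by (simp add: vec_eq_iff mat_def)

lemma mat_mult_commute: "mat c ** A = A ** (mat c :: 'a::comm_semiring_1^'n^'n)"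
  by (simp add: vec_eq_iff mat_eq_diag_matrix diag_matrix_mult_left diag_matrix_mult_right mult.commute)

lemma unitary_diag_matrix_iff: "unitary_matrix (diag_matrix d) \<longleftrightarrow> (\<forall>i. norm (d i) = 1)"
proof -
  have "unitary_matrix (diag_matrix d) \<longleftrightarrow> (\<forall>i. d i * cnj (d i) = 1)"
    by (auto simp: unitary_matrix_def adjoint_diag_matrix diag_matrix_mult vec_eq_iff mat_def mult.commute)
  moreover have "z * cnj z = 1 \<longleftrightarrow> norm z = 1" for z
    by (simp add: complex_mult_cnj cmod_def complex_eq_iff)
  ultimately show ?thesis by simp
qed

section \<open>The groups and the quotient map\<close>

lemma carrier_SU: "carrier SU = {A. unitary_matrix A \<and> det A = 1}"
  and mult_SU [simp]: "A \<otimes>\<^bsub>SU\<^esub> B = A ** B"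
  and one_SU [simp]: "\<one>\<^bsub>SU\<^esub> = mat 1"
  by (simp_all add: SU_def)

lemma SU_mult_closed: "A \<in> carrier SU \<Longrightarrow> B \<in> carrier SU \<Longrightarrow> A ** B \<in> carrier SU"
  by (simp add: carrier_SU unitary_matrix_mult det_mul)

lemma SU_adjoint_closed: "A \<in> carrier SU \<Longrightarrow> adjoint_matrix A \<in> carrier SU"
  by (simp add: carrier_SU unitary_matrix_adjoint det_adjoint_matrix)

lemma mat_1_in_SU: "mat 1 \<in> carrier SU"
  by (simp add: carrier_SU unitary_matrix_def)

lemma SU_adjoint_mult:
  assumes "A \<in> carrier SU"
  shows "A ** adjoint_matrix A = mat 1" "adjoint_matrix A ** A = mat 1"
  using assms by (simp_all add: carrier_SU unitary_matrix_def)

lemma group_SU: "group (SU :: (complex^'n^'n) monoid)"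
proof (rule groupI)
  show "\<exists>B\<in>carrier SU. B \<otimes>\<^bsub>SU\<^esub> A = \<one>\<^bsub>SU\<^esub>" if "A \<in> carrier SU" for A :: "complex^'n^'n"
    using that SU_adjoint_closed SU_adjoint_mult by auto
qed (auto simp: SU_mult_closed mat_1_in_SU matrix_mul_assoc)

lemma inv_SU: "A \<in> carrier SU \<Longrightarrow> inv\<^bsub>SU\<^esub> A = adjoint_matrix A"
  by (intro group.inv_equality[OF group_SU]) (auto simp: SU_adjoint_closed SU_adjoint_mult)

text \<open>A root of unity has modulus one, and the determinant of \<open>mat \<zeta>\<close> is
  the power of \<zeta> with exponent \<open>CARD('n)\<close>. In this form closure of the scalars
  under the group operations is inherited from \<open>SU\<close>.\<close>

lemma SU_scalars_eq: "SU_scalars = {A \<in> carrier SU. \<exists>\<zeta>. A = mat \<zeta>}"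
  unfolding SU_scalars_def carrier_SU mat_eq_diag_matrix
  by (auto simp: unitary_diag_matrix_iff det_diag_matrix dest: power_eq_1_iff)

lemma normal_SU_scalars: "SU_scalars \<lhd> (SU :: (complex^'n^'n) monoid)"
proof (rule group.normalI[OF group_SU])
  interpret group "SU :: (complex^'n^'n) monoid" by (rule group_SU)
  show "subgroup (SU_scalars :: (complex^'n^'n) set) SU"
  proof (rule subgroupI)
    show "inv\<^bsub>SU\<^esub> A \<in> SU_scalars" if "A \<in> SU_scalars" for A :: "complex^'n^'n"
      using that unfolding SU_scalars_eq mat_eq_diag_matrix
      by (auto simp: inv_SU SU_adjoint_closed adjoint_diag_matrix)
    show "A \<otimes>\<^bsub>SU\<^esub> B \<in> SU_scalars" if "A \<in> SU_scalars" "B \<in> SU_scalars" for A B :: "complex^'n^'n"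
      using that unfolding SU_scalars_eq mat_eq_diag_matrix
      by (auto simp: SU_mult_closed diag_matrix_mult)
    show "(SU_scalars :: (complex^'n^'n) set) \<noteq> {}"
      using mat_1_in_SU unfolding SU_scalars_eq by blast
  qed (auto simp: SU_scalars_eq)
  show "\<forall>A\<in>carrier SU. SU_scalars #>\<^bsub>SU\<^esub> A = A <#\<^bsub>SU\<^esub> (SU_scalars :: (complex^'n^'n) set)"
    by (auto simp: SU_scalars_def r_coset_def l_coset_def mat_mult_commute)
qed

lemma group_PSU: "group PSU"
  unfolding PSU_def by (rule normal.factorgroup_is_group[OF normal_SU_scalars])

lemma carrier_PSU: "carrier PSU = PSU_proj ` carrier SU"
  unfolding PSU_def carrier_FactGroup PSU_proj_def by simp

lemma PSU_proj_in_PSU: "A \<in> carrier SU \<Longrightarrow> PSU_proj A \<in> carrier PSU"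
  by (simp add: carrier_PSU)

lemma PSU_proj_mult:
  "A \<in> carrier SU \<Longrightarrow> B \<in> carrier SU \<Longrightarrow> PSU_proj A \<otimes>\<^bsub>PSU\<^esub> PSU_proj B = PSU_proj (A ** B)"
  unfolding PSU_def PSU_proj_def mult_FactGroup
  by (simp add: normal.rcos_sum[OF normal_SU_scalars])

lemma PSU_proj_inv:
  assumes "A \<in> carrier SU"
  shows "inv\<^bsub>PSU\<^esub> PSU_proj A = PSU_proj (adjoint_matrix A)"
  using assms
  by (simp add: PSU_def PSU_proj_def carrier_FactGroup normal.inv_FactGroup[OF normal_SU_scalars]
      normal.rcos_inv[OF normal_SU_scalars] inv_SU)

lemma PSU_proj_eq_iff:
  fixes A B :: "complex^'n^'n"
  assumes "A \<in> carrier SU" "B \<in> carrier SU"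
  shows "PSU_proj A = PSU_proj B \<longleftrightarrow> (\<exists>\<zeta>. \<zeta> ^ CARD('n) = 1 \<and> A = mat \<zeta> ** B)"
proof -
  interpret group "SU :: (complex^'n^'n) monoid" by (rule group_SU)
  have sub: "subgroup SU_scalars (SU :: (complex^'n^'n) monoid)"
    by (rule normal_imp_subgroup[OF normal_SU_scalars])
  have "PSU_proj A = PSU_proj B \<longleftrightarrow> A \<in> SU_scalars #>\<^bsub>SU\<^esub> B"
  proof
    assume "PSU_proj A = PSU_proj B"
    then show "A \<in> SU_scalars #>\<^bsub>SU\<^esub> B"
      using repr_independenceD[OF sub assms(1)] unfolding PSU_proj_def by simp
  next
    assume "A \<in> SU_scalars #>\<^bsub>SU\<^esub> B"
    then show "PSU_proj A = PSU_proj B"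
      using repr_independence[OF _ assms(2) sub] unfolding PSU_proj_def by simp
  qed
  also have "\<dots> \<longleftrightarrow> (\<exists>\<zeta>. \<zeta> ^ CARD('n) = 1 \<and> A = mat \<zeta> ** B)"
    by (auto simp: r_coset_def SU_scalars_def)
  finally show ?thesis .
qed

section \<open>The diagonal subgroup\<close>

lemma SU_diagonalE:
  assumes "A \<in> SU_diagonal"
  obtains a where "A = diag_matrix a" "\<And>i. norm (a i) = 1" "(\<Prod>i\<in>UNIV. a i) = 1"
proof -
  from assms have A: "A = diag_matrix (\<lambda>i. A $ i $ i)"
    by (simp add: SU_diagonal_def vec_eq_iff)
  moreover have "unitary_matrix (diag_matrix (\<lambda>i. A $ i $ i))"
    "det (diag_matrix (\<lambda>i. A $ i $ i)) = 1"
    using assms A by (simp_all add: SU_diagonal_def carrier_SU)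
  ultimately show ?thesis
    using that unfolding unitary_diag_matrix_iff det_diag_matrix by blast
qed

lemma diag_matrix_in_SU_diagonal:
  "(\<And>i. norm (a i) = 1) \<Longrightarrow> (\<Prod>i\<in>UNIV. a i) = 1 \<Longrightarrow> diag_matrix a \<in> SU_diagonal"
  by (simp add: SU_diagonal_def carrier_SU unitary_diag_matrix_iff det_diag_matrix)

lemma SU_diagonal_subset: "SU_diagonal \<subseteq> carrier SU"
  by (auto simp: SU_diagonal_def)

lemma PSU_diagonal_subset: "PSU_diagonal \<subseteq> carrier PSU"
  using SU_diagonal_subset by (auto simp: PSU_diagonal_def carrier_PSU)

lemma PSU_proj_diag_mult:
  "A \<in> SU_diagonal \<Longrightarrow> B \<in> SU_diagonal \<Longrightarrow> PSU_proj A \<otimes>\<^bsub>PSU\<^esub> PSU_proj B = PSU_proj (A ** B)"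
  using SU_diagonal_subset PSU_proj_mult by blast

lemma SU_diagonal_mult: "A \<in> SU_diagonal \<Longrightarrow> B \<in> SU_diagonal \<Longrightarrow> A ** B \<in> SU_diagonal"
  by (elim SU_diagonalE)
    (auto simp: diag_matrix_mult norm_mult prod.distrib intro!: diag_matrix_in_SU_diagonal)

lemma SU_diagonal_adjoint: "A \<in> SU_diagonal \<Longrightarrow> adjoint_matrix A \<in> SU_diagonal"
  by (auto simp: SU_diagonal_def SU_adjoint_closed)

lemma SU_diagonal_commute: "A \<in> SU_diagonal \<Longrightarrow> B \<in> SU_diagonal \<Longrightarrow> A ** B = B ** A"
  by (elim SU_diagonalE) (simp add: diag_matrix_mult mult.commute)

text \<open>Scalar multiples of diagonal matrices are diagonal, so the set of diagonal matrices is
  saturated for the quotient map.\<close>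

lemma PSU_proj_in_PSU_diagonal_iff:
  fixes A :: "complex^'n^'n"
  assumes "A \<in> carrier SU"
  shows "PSU_proj A \<in> PSU_diagonal \<longleftrightarrow> A \<in> SU_diagonal"
proof
  assume "PSU_proj A \<in> PSU_diagonal"
  then obtain B where B: "B \<in> SU_diagonal" "PSU_proj A = PSU_proj B"
    by (auto simp: PSU_diagonal_def)
  then obtain \<zeta> where "A = mat \<zeta> ** B"
    using PSU_proj_eq_iff[OF assms] SU_diagonal_subset by blast
  then have "A $ i $ j = 0" if "i \<noteq> j" for i j
    using B(1) that by (simp add: SU_diagonal_def mat_eq_diag_matrix diag_matrix_mult_left)
  then show "A \<in> SU_diagonal"
    using assms by (simp add: SU_diagonal_def)
qed (simp add: PSU_diagonal_def)

lemma subgroup_PSU_diagonal: "subgroup PSU_diagonal (PSU :: (complex^'n^'n) set monoid)"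
proof (rule group.subgroupI[OF group_PSU PSU_diagonal_subset])
  show "PSU_diagonal \<noteq> ({} :: (complex^'n^'n) set set)"
    using PSU_proj_in_PSU_diagonal_iff[OF mat_1_in_SU] mat_1_in_SU
    by (auto simp: SU_diagonal_def mat_def)
  show "inv\<^bsub>PSU\<^esub> p \<in> PSU_diagonal" if "p \<in> PSU_diagonal" for p :: "(complex^'n^'n) set"
    using that SU_diagonal_subset
    by (auto simp: PSU_diagonal_def PSU_proj_inv subset_iff SU_diagonal_adjoint)
  show "p \<otimes>\<^bsub>PSU\<^esub> q \<in> PSU_diagonal"
    if "p \<in> PSU_diagonal" "q \<in> PSU_diagonal" for p q :: "(complex^'n^'n) set"
    using that by (auto simp: PSU_diagonal_def PSU_proj_diag_mult SU_diagonal_mult)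
qed

lemma abelian_subgroup_iff:
  "abelian_subgroup H \<longleftrightarrow> subgroup H PSU \<and> (\<forall>p\<in>H. \<forall>q\<in>H. p \<otimes>\<^bsub>PSU\<^esub> q = q \<otimes>\<^bsub>PSU\<^esub> p)"
proof -
  have "comm_group (PSU\<lparr>carrier := H\<rparr>) \<longleftrightarrow> (\<forall>p\<in>H. \<forall>q\<in>H. p \<otimes>\<^bsub>PSU\<^esub> q = q \<otimes>\<^bsub>PSU\<^esub> p)"
    if "subgroup H PSU"
  proof -
    interpret H: group "PSU\<lparr>carrier := H\<rparr>"
      by (rule subgroup.subgroup_is_group[OF that group_PSU])
    show ?thesis
    proof
      assume "comm_group (PSU\<lparr>carrier := H\<rparr>)"
      then interpret C: comm_group "PSU\<lparr>carrier := H\<rparr>" .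
      show "\<forall>p\<in>H. \<forall>q\<in>H. p \<otimes>\<^bsub>PSU\<^esub> q = q \<otimes>\<^bsub>PSU\<^esub> p"
        using C.m_comm by simp
    qed (auto intro: H.group_comm_groupI)
  qed
  then show ?thesis
    unfolding abelian_subgroup_def by blast
qed

lemma abelian_subgroup_PSU_diagonal: "abelian_subgroup (PSU_diagonal :: (complex^'n^'n) set set)"
  unfolding abelian_subgroup_iff
proof (intro conjI ballI subgroup_PSU_diagonal)
  fix p q :: "(complex^'n^'n) set"
  assume "p \<in> PSU_diagonal" "q \<in> PSU_diagonal"
  then obtain A B where "A \<in> SU_diagonal" "p = PSU_proj A" "B \<in> SU_diagonal" "q = PSU_proj B"
    unfolding PSU_diagonal_def by blast
  then show "p \<otimes>\<^bsub>PSU\<^esub> q = q \<otimes>\<^bsub>PSU\<^esub> p"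
    using PSU_proj_diag_mult[of A B] PSU_proj_diag_mult[of B A] SU_diagonal_commute[of A B] by simp
qed

text \<open>Up to a scalar \<open>\<zeta>\<close>, a lift of an element centralising the diagonal subgroup commutes
  with \<open>diag(t, 1/t, 1, \<dots>, 1)\<close>. An off-diagonal entry would force \<open>t\<^sup>2\<close> to be an \<open>(n+1)\<close>-th
  root of unity.\<close>

lemma PSU_diagonal_self_centralising:
  fixes H :: "(complex^'n^'n) set set"
  assumes H: "abelian_subgroup H" and sub: "PSU_diagonal \<subseteq> H"
  shows "H = PSU_diagonal"
proof (rule antisym[OF subsetI sub])
  fix p assume p: "p \<in> H"
  then obtain B where B: "B \<in> carrier SU" "p = PSU_proj B"
    using subgroup.subset[of H PSU] H unfolding abelian_subgroup_def carrier_PSU by blast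
  have "B $ i $ j = 0" if ij: "i \<noteq> j" for i j
  proof (rule ccontr)
    assume nz: "B $ i $ j \<noteq> 0"
    \<comment> \<open>This angle settles all sizes at once: \<zeta> will be the inverse square of
      \<open>t\<close>, so its power with exponent \<open>CARD('n)\<close> is
      \<open>cis (- 2)\<close>, which is not 1 because the cosine of 2 is negative.\<close>
    define t where "t = cis (1 / real CARD('n))"
    define d where "d = (\<lambda>k. if k = i then t else if k = j then cnj t else 1)"
    have t: "t * cnj t = 1" "norm t = 1"
      by (simp_all add: t_def cis_mult cis_cnj)
    have "(\<Prod>k\<in>UNIV. d k) = t * cnj t"
    proof -
      have "(\<Prod>k\<in>UNIV. d k) = (\<Prod>k\<in>{i, j}. d k)"
        by (rule prod.mono_neutral_right) (auto simp: d_def)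
      then show ?thesis using ij by (simp add: d_def)
    qed
    then have D: "diag_matrix d \<in> SU_diagonal"
      by (intro diag_matrix_in_SU_diagonal) (auto simp: d_def t)
    then have DS: "diag_matrix d \<in> carrier SU" using SU_diagonal_subset by blast
    have "PSU_proj (diag_matrix d) \<in> H" using D sub by (auto simp: PSU_diagonal_def)
    then have "PSU_proj (B ** diag_matrix d) = PSU_proj (diag_matrix d ** B)"
      using p H B DS unfolding abelian_subgroup_iff by (metis PSU_proj_mult)
    then obtain \<zeta> where \<zeta>: "\<zeta> ^ CARD('n) = 1" "B ** diag_matrix d = mat \<zeta> ** (diag_matrix d ** B)"
      using PSU_proj_eq_iff SU_mult_closed B(1) DS by meson
    \<comment> \<open>Multiplication by \<open>diag_matrix d\<close> scales columns from the right
      and rows from the left, so the entry (i, j) picks up \<open>cnj t\<close> on one side and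
      \<open>t\<close> on the other.\<close>
    have "B $ i $ j * d j = \<zeta> * (d i * B $ i $ j)"
      using \<zeta>(2) by (metis diag_matrix_mult_left diag_matrix_mult_right mat_eq_diag_matrix)
    then have "cnj t = \<zeta> * t" using nz ij by (simp add: d_def)
    then have "\<zeta> = cnj t * cnj t"
      by (metis t(1) mult.assoc mult.commute mult.right_neutral)
    then have "\<zeta> = cis (- (2 / real CARD('n)))"
      by (simp add: t_def cis_cnj cis_mult)
    then have "\<zeta> ^ CARD('n) = cis (real CARD('n) * - (2 / real CARD('n)))"
      by (simp only: Complex.DeMoivre)
    also have "real CARD('n) * - (2 / real CARD('n)) = - 2"
      by simp
    finally have "\<zeta> ^ CARD('n) = cis (- 2)" .
    then have "cos (2::real) = 1"
      using \<zeta>(1) by (metis cis.sel(1) cos_minus one_complex.sel(1))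
    moreover have "cos (2::real) < 0"
      by (rule cos_two_less_zero)
    ultimately show False
      by simp
  qed
  then show "p \<in> PSU_diagonal"
    using B by (auto simp: PSU_diagonal_def SU_diagonal_def)
qed

section \<open>Simultaneous diagonalisation\<close>

text \<open>The list has one vector more than the dimension. Linear dependence of a set does not see
  repetitions, so a list with two equal vectors is treated separately, with coefficients 1 and
  -1.\<close>

lemma power_vectors_dependent:
  fixes A :: "'a::field^'n^'n"
  obtains c where "\<exists>k\<le>CARD('n). c k \<noteq> 0" "(\<Sum>k\<le>CARD('n). c k *s (((*v) A ^^ k) v)) = 0"
proof -
  define f where "f = (\<lambda>k. ((*v) A ^^ k) v)"
  show thesis
  proof (cases "inj_on f {..CARD('n)}")
    case True
    have "vec.dependent (f ` {..CARD('n)})"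
      using vec.independent_bound_general[of "f ` {..CARD('n)}"] vec.dim_subset_UNIV[of "f ` {..CARD('n)}"]
      by (auto simp: card_image[OF True] vec.dimension_def card_cart_basis)
    then obtain u where u: "\<exists>x\<in>f ` {..CARD('n)}. u x \<noteq> 0" "(\<Sum>x\<in>f ` {..CARD('n)}. u x *s x) = 0"
      using vec.dependent_finite[of "f ` {..CARD('n)}"] by auto
    show thesis
    proof (rule that[of "\<lambda>k. u (f k)"])
      show "(\<Sum>k\<le>CARD('n). u (f k) *s ((*v) A ^^ k) v) = 0"
        using u(2) unfolding sum.reindex[OF True] by (simp add: f_def)
    qed (use u(1) in auto)
  next
    case False
    then obtain k l where kl: "k \<le> CARD('n)" "l \<le> CARD('n)" "k \<noteq> l" "f k = f l"
      by (auto simp: inj_on_def)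
    define c :: "nat \<Rightarrow> 'a" where "c = (\<lambda>j. if j = k then 1 else if j = l then - 1 else 0)"
    have "(\<Sum>j\<le>CARD('n). c j *s f j) = (\<Sum>j\<in>{k, l}. c j *s f j)"
      by (rule sum.mono_neutral_right) (use kl in \<open>auto simp: c_def\<close>)
    then have "(\<Sum>j\<le>CARD('n). c j *s f j) = 0"
      using kl by (simp add: c_def)
    moreover have "c k \<noteq> 0"
      by (simp add: c_def)
    ultimately show thesis
      using that[of c] kl(1) unfolding f_def by blast
  qed
qed

text \<open>The sum is p(A) v. A root \<mu> of p gives p = (x - \<mu>) q, so q(A) annihilates u = (A
  - \<mu>) v. Either u = 0 and v is an eigenvector, or u takes the place of v and the degree bound
  drops. All vectors stay in the invariant \<open>W\<close>, so the restriction of \<open>A\<close>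
  to \<open>W\<close> never has to be represented by a matrix.\<close>

lemma eigenvector_if_annihilated:
  fixes A :: "complex^'n^'n"
  assumes W: "vec.subspace W" "\<And>w. w \<in> W \<Longrightarrow> A *v w \<in> W"
  shows "degree p \<le> d \<Longrightarrow> p \<noteq> 0 \<Longrightarrow> (\<Sum>k\<le>d. coeff p k *s (((*v) A ^^ k) v)) = 0 \<Longrightarrow>
    v \<in> W \<Longrightarrow> v \<noteq> 0 \<Longrightarrow> \<exists>w\<in>W. w \<noteq> 0 \<and> (\<exists>\<mu>. A *v w = \<mu> *s w)"
proof (induction d arbitrary: p v)
  case 0
  then have "coeff p 0 \<noteq> 0"
    by (metis leading_coeff_0_iff le_zero_eq)
  with 0 show ?case
    by (simp add: vec_eq_iff)
next
  case (Suc d)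
  define f where "f = (\<lambda>k. ((*v) A ^^ k) v)"
  show ?case
  proof (cases "degree p = 0")
    case True
    then have "coeff p 0 \<noteq> 0"
      using Suc.prems(2) by (metis leading_coeff_0_iff)
    moreover have "(\<Sum>k\<le>Suc d. coeff p k *s f k) = coeff p 0 *s f 0"
      by (rule sum.mono_neutral_right[where S = "{0}", simplified]) (auto simp: True coeff_eq_0)
    ultimately show ?thesis
      using Suc.prems(3,5) by (simp add: f_def vec_eq_iff)
  next
    case False
    then obtain \<mu> where "poly p \<mu> = 0"
      using alg_closed_imp_poly_has_root[of p] by auto
    then obtain q where q: "p = [:- \<mu>, 1:] * q"
      by (auto simp: poly_eq_0_iff_dvd dvd_def)
    have q0: "q \<noteq> 0" using Suc.prems(2) q by auto
    then have dq: "degree q \<le> d"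
      using Suc.prems(1) degree_mult_eq[of "[:- \<mu>, 1:]" q] unfolding q by (auto simp del: mult_pCons_left)
    define u where "u = A *v v - \<mu> *s v"
    have fu: "((*v) A ^^ k) u = f (Suc k) - \<mu> *s f k" for k
      by (induction k)
        (simp_all add: u_def f_def matrix_vector_mult_diff_distrib vector_scalar_commute funpow_swap1)
    have "(\<Sum>k\<le>d. coeff q k *s (((*v) A ^^ k) u))
        = (\<Sum>k\<le>d. coeff q k *s f (Suc k)) - (\<Sum>k\<le>d. (\<mu> * coeff q k) *s f k)"
      by (simp add: fu vec.scale_right_diff_distrib sum_subtractf mult.commute)
    \<comment> \<open>The added term vanishes because q has degree at most \<open>d\<close>. The
      longer range can be split at 0, after which p = x q - \<mu> q is compared coefficient by
      coefficient.\<close>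
    also have "(\<Sum>k\<le>d. (\<mu> * coeff q k) *s f k) = (\<Sum>k\<le>Suc d. (\<mu> * coeff q k) *s f k)"
      using dq by (simp add: coeff_eq_0)
    also have "\<dots> = (\<mu> * coeff q 0) *s f 0 + (\<Sum>k\<le>d. (\<mu> * coeff q (Suc k)) *s f (Suc k))"
      by (rule sum.atMost_Suc_shift)
    also have "(\<Sum>k\<le>d. coeff q k *s f (Suc k)) - \<dots> = (\<Sum>k\<le>Suc d. coeff p k *s f k)"
      unfolding sum.atMost_Suc_shift
      by (simp add: q vec.scale_left_diff_distrib sum_subtractf vector_sneg_minus1[symmetric])
    also have "\<dots> = 0"
      using Suc.prems(3) by (simp add: f_def)
    finally have sum0: "(\<Sum>k\<le>d. coeff q k *s (((*v) A ^^ k) u)) = 0" .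
    have "u \<in> W"
      unfolding u_def using W Suc.prems(4) by (simp add: vec.subspace_diff vec.subspace_scale)
    then show ?thesis
      using Suc.IH[OF dq q0 sum0] Suc.prems(4,5) by (cases "u = 0") (auto simp: u_def)
  qed
qed

lemma eigenvector_exists:
  fixes A :: "complex^'n^'n"
  assumes "vec.subspace W" "W \<noteq> {0}" "\<And>w. w \<in> W \<Longrightarrow> A *v w \<in> W"
  obtains w \<mu> where "w \<in> W" "w \<noteq> 0" "A *v w = \<mu> *s w"
proof -
  obtain v where v: "v \<in> W" "v \<noteq> 0"
    using assms(1,2) vec.subspace_0 by blast
  obtain c where c: "\<exists>k\<le>CARD('n). c k \<noteq> 0" "(\<Sum>k\<le>CARD('n). c k *s (((*v) A ^^ k) v)) = 0"
    by (rule power_vectors_dependent)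
  define p where "p = (\<Sum>k\<le>CARD('n). monom (c k) k)"
  have coeff: "coeff p k = (if k \<le> CARD('n) then c k else 0)" for k
    by (simp add: p_def coeff_sum)
  have "degree p \<le> CARD('n)"
    by (rule degree_le) (simp add: coeff)
  moreover have "p \<noteq> 0"
    using c(1) coeff by (auto simp: poly_eq_iff)
  moreover have "(\<Sum>k\<le>CARD('n). coeff p k *s (((*v) A ^^ k) v)) = 0"
    using c(2) by (simp add: coeff)
  ultimately show thesis
    using eigenvector_if_annihilated[OF assms(1,3) _ _ _ v] that by blast
qed

text \<open>Induction on the dimension. If every matrix in \<open>S\<close> is scalar on
  \<open>W\<close>, any nonzero vector will do. Otherwise an eigenspace of some \<open>A\<close>
  within \<open>W\<close> is smaller, and commutation makes it invariant under \<open>S\<close>. The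
  dimension bounds the descent even if \<open>S\<close> is infinite.\<close>

lemma common_eigenvector_exists:
  fixes S :: "(complex^'n^'n) set"
  assumes "\<And>A B. A \<in> S \<Longrightarrow> B \<in> S \<Longrightarrow> A ** B = B ** A"
    and "vec.subspace W" "W \<noteq> {0}" "\<And>A w. A \<in> S \<Longrightarrow> w \<in> W \<Longrightarrow> A *v w \<in> W"
  shows "\<exists>w\<in>W. w \<noteq> 0 \<and> (\<forall>A\<in>S. \<exists>\<mu>. A *v w = \<mu> *s w)"
  using assms(2-)
proof (induction "vec.dim W" arbitrary: W rule: less_induct)
  case less
  show ?case
  proof (cases "\<forall>A\<in>S. \<exists>\<mu>. \<forall>w\<in>W. A *v w = \<mu> *s w")
    case True
    then show ?thesis
      using less.prems(1,2) vec.subspace_0 by blast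
  next
    case False
    then obtain A where A: "A \<in> S" "\<And>\<mu>. \<exists>w\<in>W. A *v w \<noteq> \<mu> *s w"
      by blast
    obtain v \<mu> where v: "v \<in> W" "v \<noteq> 0" "A *v v = \<mu> *s v"
      using eigenvector_exists[OF less.prems(1,2) less.prems(3)[OF A(1)]] by blast
    define W' where "W' = {w \<in> W. A *v w = \<mu> *s w}"
    have W': "vec.subspace W'"
      using less.prems(1) unfolding W'_def vec.subspace_def
      by (auto simp: matrix_vector_right_distrib vector_scalar_commute vector_add_ldistrib
          vector_smult_assoc mult.commute)
    have "W' \<subset> W"
      using A(2)[of \<mu>] by (auto simp: W'_def)
    then have "vec.dim W' < vec.dim W"
      using vec.subspace_dim_equal[OF W' less.prems(1)] by (metis not_less psubset_eq)
    moreover have "W' \<noteq> {0}"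
      using v by (auto simp: W'_def)
    moreover have "B *v w \<in> W'" if "B \<in> S" "w \<in> W'" for B w
    proof -
      have "A *v (B *v w) = B *v (A *v w)"
        using assms(1)[OF A(1) that(1)] by (simp add: matrix_vector_mul_assoc)
      then show ?thesis
        using that less.prems(3) by (simp add: W'_def vector_scalar_commute)
    qed
    ultimately obtain w where "w \<in> W'" "w \<noteq> 0" "\<forall>A\<in>S. \<exists>\<mu>. A *v w = \<mu> *s w"
      using less.hyps[OF _ W'] by blast
    then show ?thesis
      by (auto simp: W'_def)
  qed
qed

section \<open>Orthonormal eigenbases of commuting unitary matrices\<close>

definition hermitian_inner :: "complex^'n \<Rightarrow> complex^'n \<Rightarrow> complex" where
  "hermitian_inner x y = (\<Sum>k\<in>UNIV. cnj (x $ k) * y $ k)"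

lemma hermitian_inner_simps:
  "hermitian_inner x (y + z) = hermitian_inner x y + hermitian_inner x z"
  "hermitian_inner x (c *s y) = c * hermitian_inner x y"
  "hermitian_inner (c *s x) y = cnj c * hermitian_inner x y"
  "hermitian_inner x 0 = 0"
  by (simp_all add: hermitian_inner_def sum.distrib sum_distrib_left algebra_simps)

lemma cnj_hermitian_inner: "cnj (hermitian_inner x y) = hermitian_inner y x"
  by (simp add: hermitian_inner_def mult.commute)

lemma hermitian_inner_self: "hermitian_inner x x = complex_of_real ((norm x)\<^sup>2)"
  by (simp add: hermitian_inner_def norm_vec_def L2_set_def sum_nonneg complex_norm_square
      mult.commute del: of_real_power)

lemma hermitian_inner_mult:
  "hermitian_inner x (A *v y) = hermitian_inner (adjoint_matrix A *v x) y"
  unfolding hermitian_inner_def matrix_vector_mult_def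
  by (simp add: sum_distrib_left sum_distrib_right) (subst sum.swap, simp add: mult_ac)

text \<open>Applying the adjoint to \<open>A *v x = \<mu> *s x\<close> writes x as \<mu> times its
  image under the adjoint. This is what makes the orthogonal complement of eigenvectors
  invariant.\<close>

lemma unitary_matrix_adjoint_eigenvector:
  assumes "unitary_matrix A" "A *v x = \<mu> *s x" "x \<noteq> 0"
  shows "adjoint_matrix A *v x = (1 / \<mu>) *s x"
proof -
  have x: "x = \<mu> *s (adjoint_matrix A *v x)"
  proof -
    have "x = adjoint_matrix A *v (A *v x)"
      using assms(1) by (simp add: matrix_vector_mul_assoc unitary_matrixD)
    then show ?thesis
      by (simp add: assms(2) vector_scalar_commute)
  qed
  then have "\<mu> \<noteq> 0" "(1 / \<mu>) *s x = (1 / \<mu>) *s (\<mu> *s (adjoint_matrix A *v x))"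
    using assms(3) by auto
  then show ?thesis
    by (simp add: vector_smult_assoc)
qed

text \<open>The conditions for j in \<open>J\<close> are rows of a square matrix whose row
  \<open>i\<close> is zero. It is singular, so its kernel is nontrivial; this replaces a dimension
  count.\<close>

lemma hermitian_orthogonal_exists:
  fixes u :: "'n \<Rightarrow> complex^'n::finite"
  assumes "i \<notin> J"
  shows "\<exists>w. w \<noteq> 0 \<and> (\<forall>j\<in>J. hermitian_inner (u j) w = 0)"
proof -
  define M :: "complex^'n^'n" where "M = (\<chi> j k. if j \<in> J then cnj (u j $ k) else 0)"
  have "row i M = 0"
    using assms by (simp add: M_def row_def vec_eq_iff)
  then have "det M = 0"
    using det_zero_row(1) by blast
  then have "\<not> (\<exists>B. B ** M = mat 1)"
    using invertible_det_nz invertible_left_inverse by blast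
  then obtain w where w: "w \<noteq> 0" "M *v w = 0"
    unfolding matrix_left_invertible_ker by blast
  have "hermitian_inner (u j) w = (M *v w) $ j" if "j \<in> J" for j
    using that by (simp add: M_def hermitian_inner_def matrix_vector_mult_def)
  then show ?thesis
    using w by auto
qed

text \<open>Each new index of \<open>J\<close> gets a common eigenvector from the orthogonal
  complement of the earlier ones, which is invariant because these are eigenvectors of the adjoints
  too. Indexing by the type \<open>'n\<close> itself lets the complete family form a matrix.\<close>

lemma orthonormal_common_eigenvectors:
  fixes S :: "(complex^'n^'n) set"
  assumes comm: "\<And>A B. A \<in> S \<Longrightarrow> B \<in> S \<Longrightarrow> A ** B = B ** A"
    and unit: "\<And>A. A \<in> S \<Longrightarrow> unitary_matrix A"
  shows "\<exists>u :: 'n \<Rightarrow> complex^'n.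
    (\<forall>i\<in>J. \<forall>j\<in>J. hermitian_inner (u i) (u j) = (if i = j then 1 else 0)) \<and>
    (\<forall>j\<in>J. \<forall>A\<in>S. \<exists>\<mu>. A *v u j = \<mu> *s u j)"
  using finite[of J]
proof (induction J)
  case empty
  then show ?case by simp
next
  case (insert i J)
  then obtain u where u: "\<And>i j. i \<in> J \<Longrightarrow> j \<in> J \<Longrightarrow> hermitian_inner (u i) (u j) = (if i = j then 1 else 0)"
    "\<And>j A. j \<in> J \<Longrightarrow> A \<in> S \<Longrightarrow> \<exists>\<mu>. A *v u j = \<mu> *s u j"
    by blast
  define W where "W = {w. \<forall>j\<in>J. hermitian_inner (u j) w = 0}"
  have "vec.subspace W"
    by (auto simp: W_def vec.subspace_def hermitian_inner_simps)
  moreover have "W \<noteq> {0}"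
    using hermitian_orthogonal_exists[OF insert.hyps(2), of u] unfolding W_def by blast
  moreover have "A *v w \<in> W" if "A \<in> S" "w \<in> W" for A w
  proof -
    have "hermitian_inner (u j) (A *v w) = 0" if j: "j \<in> J" for j
    proof -
      obtain \<mu> where \<mu>: "A *v u j = \<mu> *s u j"
        using u(2)[OF j \<open>A \<in> S\<close>] by blast
      have "u j \<noteq> 0"
        using u(1)[OF j j] by (auto simp: hermitian_inner_simps)
      then have "adjoint_matrix A *v u j = (1 / \<mu>) *s u j"
        using unitary_matrix_adjoint_eigenvector[OF unit[OF \<open>A \<in> S\<close>] \<mu>] by blast
      then show ?thesis
        using \<open>w \<in> W\<close> j by (simp add: hermitian_inner_mult hermitian_inner_simps W_def)
    qed
    then show ?thesis
      by (simp add: W_def)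
  qed
  ultimately have "\<exists>w\<in>W. w \<noteq> 0 \<and> (\<forall>A\<in>S. \<exists>\<mu>. A *v w = \<mu> *s w)"
    by (intro common_eigenvector_exists comm)
  then obtain w where w: "w \<in> W" "w \<noteq> 0" "\<And>A. A \<in> S \<Longrightarrow> \<exists>\<mu>. A *v w = \<mu> *s w"
    by blast
  define w' where "w' = complex_of_real (1 / norm w) *s w"
  have w'1: "hermitian_inner w' w' = 1"
    unfolding w'_def hermitian_inner_simps(2,3) unfolding hermitian_inner_self using w(2)
    by (simp add: power2_eq_square)
  have orth: "hermitian_inner (u j) w' = 0" if "j \<in> J" for j
    using w(1) that by (simp add: w'_def hermitian_inner_simps W_def)
  have orth': "hermitian_inner w' (u j) = 0" if "j \<in> J" for j
    using orth[OF that] cnj_hermitian_inner[of "u j" w'] by simp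
  have eig: "\<exists>\<mu>. A *v w' = \<mu> *s w'" if A: "A \<in> S" for A
  proof -
    obtain \<mu> where "A *v w = \<mu> *s w" using w(3)[OF A] by blast
    then have "A *v w' = \<mu> *s w'"
      by (simp add: w'_def vector_scalar_commute vector_smult_assoc mult.commute)
    then show ?thesis by blast
  qed
  have ne: "j \<noteq> i" if "j \<in> J" for j
    using that insert.hyps(2) by blast
  show ?case
    by (intro exI[of _ "u(i := w')"] conjI ballI)
      (auto simp: w'1 orth orth' ne u(1) eig intro: u(2))
qed

lemma simultaneously_diagonalisable:
  fixes S :: "(complex^'n^'n) set"
  assumes S: "S \<subseteq> carrier SU" and comm: "\<And>A B. A \<in> S \<Longrightarrow> B \<in> S \<Longrightarrow> A ** B = B ** A"
  obtains Q where "Q \<in> carrier SU" "\<And>A. A \<in> S \<Longrightarrow> Q ** A ** adjoint_matrix Q \<in> SU_diagonal"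
proof -
  obtain u :: "'n \<Rightarrow> complex^'n" where
    u: "\<And>i j. hermitian_inner (u i) (u j) = (if i = j then 1 else 0)"
       "\<And>j A. A \<in> S \<Longrightarrow> \<exists>\<mu>. A *v u j = \<mu> *s u j"
  proof -
    have unit: "unitary_matrix A" if "A \<in> S" for A
      using S that by (auto simp: carrier_SU)
    have "\<exists>u :: 'n \<Rightarrow> complex^'n. (\<forall>i j. hermitian_inner (u i) (u j) = (if i = j then 1 else 0)) \<and>
        (\<forall>j. \<forall>A\<in>S. \<exists>\<mu>. A *v u j = \<mu> *s u j)"
      using orthonormal_common_eigenvectors[of S UNIV] comm unit by simp
    then show thesis
      using that by blast
  qed
  \<comment> \<open>With the conjugated eigenvectors as rows, conjugation of \<open>A\<close> by
    \<open>M\<close> has the entries \<open>hermitian_inner (u i) (A *v u j)\<close>. They vanish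
    off the diagonal because \<open>u j\<close> is an eigenvector.\<close>
  define M where "M = (\<chi> i j. cnj (u i $ j))"
  have M_mult: "(M ** A ** adjoint_matrix M) $ i $ j = hermitian_inner (u i) (A *v u j)" for A i j
  proof -
    have "(A ** adjoint_matrix M) $ k $ j = (A *v u j) $ k" for k
      by (simp add: matrix_matrix_mult_def matrix_vector_mult_def M_def)
    moreover have "(M ** B) $ i $ j = (\<Sum>k\<in>UNIV. cnj (u i $ k) * B $ k $ j)" for B :: "complex^'n^'n"
      by (simp add: matrix_matrix_mult_def M_def)
    ultimately show ?thesis
      by (simp add: matrix_mul_assoc[symmetric] hermitian_inner_def)
  qed
  have "M ** adjoint_matrix M = mat 1"
    using M_mult[of "mat 1"] u(1) by (simp add: vec_eq_iff) (simp add: mat_def)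
  then have M: "unitary_matrix M"
    using matrix_left_right_inverse by (auto simp: unitary_matrix_def)
  then have nd: "norm (det M) = 1"
    by (rule norm_det_unitary_matrix)
  \<comment> \<open>\<open>M\<close> is only unitary. A scalar of modulus one corrects its
    determinant; it multiplies the entries of the conjugate by constants, so zeros remain
    zeros.\<close>
  obtain c where c: "c ^ CARD('n) = 1 / det M"
    using nth_root_exists[of "CARD('n)" "1 / det M"] by auto
  then have "norm c ^ CARD('n) = 1"
    using nd by (metis norm_divide norm_one norm_power div_by_1)
  then have nc: "norm c = 1"
    using power_eq_1_iff[of "norm c" "CARD('n)"] by simp
  define Q where "Q = mat c ** M"
  have "unitary_matrix (mat c :: complex^'n^'n)"
    by (simp add: mat_eq_diag_matrix unitary_diag_matrix_iff nc)
  moreover have "det (mat c :: complex^'n^'n) = 1 / det M"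
    by (simp add: mat_eq_diag_matrix det_diag_matrix c)
  moreover have "det M \<noteq> 0" using nd by auto
  ultimately have Q: "Q \<in> carrier SU"
    using M by (simp add: Q_def carrier_SU unitary_matrix_mult det_mul)
  show thesis
  proof (rule that[OF Q])
    fix A assume A: "A \<in> S"
    have "(Q ** A ** adjoint_matrix Q) $ i $ j = 0" if "i \<noteq> j" for i j
    proof -
      obtain \<mu> where \<mu>: "A *v u j = \<mu> *s u j" using u(2)[OF A] by blast
      have "Q ** A ** adjoint_matrix Q = mat c ** (M ** A ** adjoint_matrix M) ** mat (cnj c)"
        by (simp add: Q_def adjoint_matrix_mult mat_eq_diag_matrix adjoint_diag_matrix matrix_mul_assoc)
      then show ?thesis
        using that by (simp add: mat_eq_diag_matrix diag_matrix_mult_left diag_matrix_mult_right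
            M_mult \<mu> hermitian_inner_simps u(1))
    qed
    then show "Q ** A ** adjoint_matrix Q \<in> SU_diagonal"
      using A S Q by (auto simp: SU_diagonal_def SU_mult_closed SU_adjoint_closed)
  qed
qed

section \<open>The topology of the diagonal subgroup\<close>

lemma topspace_PSU_topology: "topspace PSU_topology = carrier (PSU :: (complex^'n^'n) set monoid)"
proof (rule antisym)
  show "topspace PSU_topology \<subseteq> carrier (PSU :: (complex^'n^'n) set monoid)"
    using openin_topspace[of PSU_topology] unfolding openin_PSU_topology by blast
  have "{A :: complex^'n^'n. A \<in> carrier SU \<and> PSU_proj A \<in> carrier PSU} = carrier SU"
    using PSU_proj_in_PSU by blast
  then have "openin PSU_topology (carrier (PSU :: (complex^'n^'n) set monoid))"
    unfolding openin_PSU_topology by (simp only:) simp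
  then show "carrier (PSU :: (complex^'n^'n) set monoid) \<subseteq> topspace PSU_topology"
    by (rule openin_subset)
qed

lemma continuous_map_PSU_proj: "continuous_map (top_of_set (carrier SU)) PSU_topology PSU_proj"
  by (auto simp: continuous_map_def topspace_PSU_topology PSU_proj_in_PSU openin_PSU_topology)

text \<open>Universal property of the quotient topology. It gives continuity of functions that are
  defined through an arbitrary lift.\<close>

lemma continuous_map_from_PSU:
  assumes "continuous_map (top_of_set (carrier SU)) Y (\<lambda>A. f (PSU_proj A))"
  shows "continuous_map PSU_topology Y f"
  unfolding continuous_map_def
proof (intro conjI allI impI)
  show "f \<in> topspace PSU_topology \<rightarrow> topspace Y"
    using assms by (auto simp: topspace_PSU_topology carrier_PSU continuous_map_def)
  fix X assume "openin Y X"
  then have "openin (top_of_set (carrier SU)) {A \<in> carrier SU. f (PSU_proj A) \<in> X}"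
    using assms by (simp add: continuous_map_def)
  moreover have "{A \<in> carrier SU. f (PSU_proj A) \<in> X}
      = {A \<in> carrier SU. PSU_proj A \<in> {p \<in> carrier PSU. f p \<in> X}}"
    using PSU_proj_in_PSU by blast
  ultimately show "openin PSU_topology {p \<in> topspace PSU_topology. f p \<in> X}"
    unfolding openin_PSU_topology topspace_PSU_topology by auto
qed

lemma continuous_map_PSU_proj_comp:
  assumes "continuous_on S F" "F ` S \<subseteq> carrier SU"
  shows "continuous_map (top_of_set S) PSU_topology (\<lambda>x. PSU_proj (F x))"
proof -
  have "continuous_map (top_of_set S) (top_of_set (carrier SU)) F"
    using assms by (auto simp: continuous_map_in_subtopology)
  from continuous_map_compose[OF this continuous_map_PSU_proj] show ?thesis
    by (simp add: comp_def)
qed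

text \<open>An arbitrary choice, with no continuity. It enters only expressions that do not change
  when the lift is multiplied by a scalar of modulus one.\<close>

definition PSU_lift :: "(complex^'n^'n) set \<Rightarrow> complex^'n^'n" where
  "PSU_lift p = (SOME A. A \<in> carrier SU \<and> PSU_proj A = p)"

lemma PSU_lift:
  assumes "p \<in> carrier PSU"
  shows "PSU_lift p \<in> carrier SU" "PSU_proj (PSU_lift p) = p"
proof -
  have "\<exists>A. A \<in> carrier SU \<and> PSU_proj A = p"
    using assms by (auto simp: carrier_PSU)
  from someI_ex[OF this] show "PSU_lift p \<in> carrier SU" "PSU_proj (PSU_lift p) = p"
    by (auto simp: PSU_lift_def)
qed

lemma PSU_lift_scalar:
  fixes A :: "complex^'n^'n"
  assumes "A \<in> carrier SU"
  obtains \<zeta> where "norm \<zeta> = 1" "PSU_lift (PSU_proj A) = mat \<zeta> ** A"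
proof -
  obtain \<zeta> where \<zeta>: "\<zeta> ^ CARD('n) = 1" "PSU_lift (PSU_proj A) = mat \<zeta> ** A"
    using PSU_lift[OF PSU_proj_in_PSU[OF assms]] PSU_proj_eq_iff[OF _ assms] by blast
  then show thesis
    using that power_eq_1_iff[OF \<zeta>(1)] by simp
qed

lemma mult_cnj_eq_1_iff: "z * cnj z = 1 \<longleftrightarrow> norm z = 1"
proof -
  have "z * cnj z = 1 \<longleftrightarrow> complex_of_real ((norm z)\<^sup>2) = complex_of_real 1"
    by (simp only: complex_norm_square of_real_1)
  also have "\<dots> \<longleftrightarrow> norm z = 1"
    unfolding of_real_eq_iff by (simp add: power2_eq_1_iff) (use norm_ge_zero[of z] in linarith)
  finally show ?thesis .
qed

text \<open>The quotients \<open>a\<^sub>i / a\<^sub>j\<close> of the diagonal entries of a lift do not depend on the lift. On the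
  diagonal subgroup they determine the element, and they serve as global coordinates.\<close>

definition PSU_ratio :: "(complex^'n^'n) set \<Rightarrow> complex^'n^'n" where
  "PSU_ratio p = (\<chi> i j. PSU_lift p $ i $ i * cnj (PSU_lift p $ j $ j))"

text \<open>The scalar between two lifts cancels against its conjugate. The formula holds on all of
  \<open>SU\<close>, which makes the ratios continuous on all of \<open>PSU\<close>.\<close>

lemma PSU_ratio_proj:
  assumes "A \<in> carrier SU"
  shows "PSU_ratio (PSU_proj A) $ i $ j = A $ i $ i * cnj (A $ j $ j)"
proof -
  obtain \<zeta> where \<zeta>: "norm \<zeta> = 1" "PSU_lift (PSU_proj A) = mat \<zeta> ** A"
    by (rule PSU_lift_scalar[OF assms])
  have "(mat \<zeta> ** A) $ k $ k = \<zeta> * A $ k $ k" for k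
    by (simp add: mat_eq_diag_matrix diag_matrix_mult_left)
  moreover have "(\<zeta> * x) * (cnj \<zeta> * y) = x * y" for x y
    using \<zeta>(1) mult_cnj_eq_1_iff[of \<zeta>] by (metis mult.assoc mult.commute mult_1)
  ultimately show ?thesis
    by (simp add: PSU_ratio_def \<zeta>(2))
qed

lemma PSU_ratio_diag:
  assumes "diag_matrix a \<in> SU_diagonal"
  shows "PSU_ratio (PSU_proj (diag_matrix a)) $ i $ j = a i * cnj (a j)"
  using PSU_ratio_proj[of "diag_matrix a" i j] assms SU_diagonal_subset by auto

lemma PSU_diagonalE:
  assumes "p \<in> PSU_diagonal"
  obtains a where "p = PSU_proj (diag_matrix a)" "diag_matrix a \<in> SU_diagonal"
    "\<And>i. norm (a i) = 1" "(\<Prod>i\<in>UNIV. a i) = 1"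
  using assms by (auto simp: PSU_diagonal_def elim!: SU_diagonalE intro: diag_matrix_in_SU_diagonal)

lemma continuous_map_PSU_ratio: "continuous_map PSU_topology euclidean PSU_ratio"
proof (rule continuous_map_from_PSU)
  have "continuous_map (top_of_set (carrier SU)) euclidean
      (\<lambda>A :: complex^'n^'n. \<chi> i j. A $ i $ i * cnj (A $ j $ j))"
    by (auto intro!: continuous_intros)
  then show "continuous_map (top_of_set (carrier SU)) euclidean (\<lambda>A :: complex^'n^'n. PSU_ratio (PSU_proj A))"
    by (rule continuous_map_eq) (simp add: vec_eq_iff PSU_ratio_proj)
qed

text \<open>Equal ratios mean that a_i / b_i is independent of i. As both determinants are 1, the
  common value is a root of unity of the order allowed in \<open>SU_scalars\<close>.\<close>

lemma inj_on_PSU_ratio: "inj_on PSU_ratio (PSU_diagonal :: (complex^'n^'n) set set)"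
proof (rule inj_onI)
  fix p q :: "(complex^'n^'n) set"
  assume p: "p \<in> PSU_diagonal" and q: "q \<in> PSU_diagonal" and eq: "PSU_ratio p = PSU_ratio q"
  obtain a where a: "p = PSU_proj (diag_matrix a)" "diag_matrix a \<in> SU_diagonal"
    "\<And>i. norm (a i) = 1" "(\<Prod>i\<in>UNIV. a i) = 1"
    using PSU_diagonalE[OF p] by blast
  obtain b where b: "q = PSU_proj (diag_matrix b)" "diag_matrix b \<in> SU_diagonal"
    "\<And>i. norm (b i) = 1" "(\<Prod>i\<in>UNIV. b i) = 1"
    using PSU_diagonalE[OF q] by blast
  obtain j :: 'n where True by simp
  define \<zeta> where "\<zeta> = a j * cnj (b j)"
  have "a i = \<zeta> * b i" for i
  proof -
    have "a i * cnj (a j) = b i * cnj (b j)"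
      using eq PSU_ratio_diag[OF a(2), of i j] PSU_ratio_diag[OF b(2), of i j] by (simp add: a(1) b(1))
    moreover have "a j * cnj (a j) = 1"
      using a(3) mult_cnj_eq_1_iff by blast
    ultimately show ?thesis
      unfolding \<zeta>_def by (metis mult.assoc mult.commute mult.right_neutral)
  qed
  then have "diag_matrix a = mat \<zeta> ** diag_matrix b"
    by (simp add: mat_eq_diag_matrix diag_matrix_mult vec_eq_iff)
  moreover have "\<zeta> ^ CARD('n) = 1"
    using a(4) b(4) \<open>\<And>i. a i = \<zeta> * b i\<close> by (simp add: prod.distrib)
  ultimately show "p = q"
    using PSU_proj_eq_iff[of "diag_matrix a" "diag_matrix b"] a(1,2) b(1,2) SU_diagonal_subset by blast
qed

text \<open>For diagonal matrices, membership in \<open>SU\<close> amounts to closed conditions on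
  the entries, which also bound them.\<close>

lemma compact_SU_diagonal: "compact (SU_diagonal :: (complex^'n^'n) set)"
proof -
  have eq: "SU_diagonal = {A :: complex^'n^'n. (\<forall>i j. i \<noteq> j \<longrightarrow> A $ i $ j = 0) \<and> (\<forall>i. norm (A $ i $ i) = 1) \<and>
      (\<Prod>i\<in>UNIV. A $ i $ i) = 1}"
  proof (intro antisym subsetI)
    fix A :: "complex^'n^'n" assume "A \<in> SU_diagonal"
    then show "A \<in> {A. (\<forall>i j. i \<noteq> j \<longrightarrow> A $ i $ j = 0) \<and> (\<forall>i. norm (A $ i $ i) = 1) \<and>
      (\<Prod>i\<in>UNIV. A $ i $ i) = 1}"
      by (elim SU_diagonalE) auto
  next
    fix A :: "complex^'n^'n"
    assume A: "A \<in> {A. (\<forall>i j. i \<noteq> j \<longrightarrow> A $ i $ j = 0) \<and> (\<forall>i. norm (A $ i $ i) = 1) \<and>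
      (\<Prod>i\<in>UNIV. A $ i $ i) = 1}"
    then have "A = diag_matrix (\<lambda>i. A $ i $ i)"
      by (simp add: vec_eq_iff)
    then show "A \<in> SU_diagonal"
      using A diag_matrix_in_SU_diagonal[of "\<lambda>i. A $ i $ i"] by simp
  qed
  have "closed (SU_diagonal :: (complex^'n^'n) set)"
    unfolding eq
    by (intro closed_Collect_conj closed_Collect_all closed_Collect_imp open_Collect_const
        closed_Collect_eq continuous_intros)
  moreover have "bounded (SU_diagonal :: (complex^'n^'n) set)"
  proof -
    have "norm A \<le> real CARD('n) * real CARD('n)" if "A \<in> SU_diagonal" for A :: "complex^'n^'n"
    proof -
      have *: "norm (A $ i $ j) \<le> 1" for i j
        using that unfolding eq by (cases "i = j") auto
      have "norm (A $ i) \<le> real CARD('n)" for i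
        unfolding norm_vec_def[of "A $ i"]
        by (rule order_trans[OF L2_set_le_sum]) (use * sum_bounded_above[of UNIV "\<lambda>j. norm (A $ i $ j)" 1] in auto)
      then show ?thesis
        unfolding norm_vec_def[of A]
        by (intro order_trans[OF L2_set_le_sum]) (use sum_bounded_above[of UNIV "\<lambda>i. norm (A $ i)" "real CARD('n)"] in auto)
    qed
    then show ?thesis
      by (auto simp: bounded_iff)
  qed
  ultimately show ?thesis
    by (simp add: compact_eq_bounded_closed)
qed

section \<open>The diagonal subgroup embedded in a linear space\<close>

abbreviation PSU_diagonal_topology :: "(complex^'n^'n) set topology" where
  "PSU_diagonal_topology \<equiv> subtopology PSU_topology PSU_diagonal"

lemma topspace_PSU_diagonal_topology: "topspace PSU_diagonal_topology = PSU_diagonal"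
  by (simp add: topspace_PSU_topology inf.absorb2 PSU_diagonal_subset)

text \<open>A continuous injection of a compact space into a Hausdorff space is a homeomorphism onto
  its image. Compactness comes from \<open>SU_diagonal\<close>, the Hausdorff property from the
  space of matrices.\<close>

lemma homeomorphic_map_PSU_ratio:
  "homeomorphic_map PSU_diagonal_topology
    (top_of_set (PSU_ratio ` (PSU_diagonal :: (complex^'n^'n) set set))) PSU_ratio"
proof -
  have "continuous_map (top_of_set SU_diagonal) PSU_topology (PSU_proj :: complex^'n^'n \<Rightarrow> _)"
    using continuous_map_PSU_proj_comp[of SU_diagonal "\<lambda>A. A"] SU_diagonal_subset by auto
  then have "compactin PSU_topology (PSU_proj ` (SU_diagonal :: (complex^'n^'n) set))"
    by (rule image_compactin[rotated]) (simp add: compactin_subtopology compact_SU_diagonal)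
  then have "compact_space (PSU_diagonal_topology :: (complex^'n^'n) set topology)"
    by (simp add: compact_space_subtopology PSU_diagonal_def)
  moreover have "continuous_map PSU_diagonal_topology
      (top_of_set (PSU_ratio ` (PSU_diagonal :: (complex^'n^'n) set set))) PSU_ratio"
    unfolding continuous_map_in_subtopology
    using continuous_map_from_subtopology[OF continuous_map_PSU_ratio]
    by (simp add: topspace_PSU_diagonal_topology image_subset_iff_funcset del: topspace_subtopology)
  ultimately show ?thesis
    by (intro continuous_imp_homeomorphic_map)
      (simp_all add: topspace_PSU_diagonal_topology inj_on_PSU_ratio Hausdorff_space_subtopology
        del: topspace_subtopology)
qed

text \<open>Since \<open>PSU_ratio\<close> has a continuous inverse on its image, continuity into
  the diagonal subgroup becomes a question about matrices.\<close>

lemma continuous_map_into_PSU_diagonal: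
  fixes f :: "'a \<Rightarrow> (complex^'n^'n) set"
  assumes "continuous_map X euclidean (\<lambda>x. PSU_ratio (f x))" "\<And>x. x \<in> topspace X \<Longrightarrow> f x \<in> PSU_diagonal"
  shows "continuous_map X PSU_diagonal_topology f"
proof -
  obtain g where g: "homeomorphic_maps PSU_diagonal_topology
    (top_of_set (PSU_ratio ` (PSU_diagonal :: (complex^'n^'n) set set))) PSU_ratio g"
    using homeomorphic_map_PSU_ratio homeomorphic_map_maps by blast
  have "continuous_map X (top_of_set (PSU_ratio ` (PSU_diagonal :: (complex^'n^'n) set set))) (\<lambda>x. PSU_ratio (f x))"
    unfolding continuous_map_in_subtopology using assms by blast
  then have "continuous_map X PSU_diagonal_topology (g \<circ> (\<lambda>x. PSU_ratio (f x)))"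
    by (rule continuous_map_compose) (use g in \<open>simp add: homeomorphic_maps_def\<close>)
  moreover have "(g \<circ> (\<lambda>x. PSU_ratio (f x))) x = f x" if "x \<in> topspace X" for x
    using g assms(2)[OF that] by (simp add: homeomorphic_maps_def topspace_PSU_diagonal_topology del: topspace_subtopology)
  ultimately show ?thesis
    by (rule continuous_map_eq)
qed

lemma continuous_map_PSU_diagonal_ratio:
  "continuous_map PSU_diagonal_topology euclidean PSU_ratio"
  by (rule continuous_map_from_subtopology[OF continuous_map_PSU_ratio])

lemma second_countable_euclidean:
  "second_countable (euclidean :: 'a::second_countable_topology topology)"
proof -
  obtain B :: "'a set set" where B: "countable B" "topological_basis B"
    using ex_countable_basis by blast
  show ?thesis
    unfolding second_countable_def
  proof (intro exI[of _ B] conjI ballI allI impI)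
    show "openin euclidean V" if "V \<in> B" for V
      using topological_basis_open[OF B(2) that] by simp
    show "\<exists>V\<in>B. x \<in> V \<and> V \<subseteq> U" if "openin euclidean U \<and> x \<in> U" for U x
      by (rule topological_basisE[OF B(2), of U x]) (use that in auto)
  qed (rule B(1))
qed

lemma homeomorphic_space_PSU_ratio:
  "(PSU_diagonal_topology :: (complex^'n^'n) set topology) homeomorphic_space
    top_of_set (PSU_ratio ` (PSU_diagonal :: (complex^'n^'n) set set))"
  by (rule homeomorphic_map_imp_homeomorphic_space[OF homeomorphic_map_PSU_ratio])

lemma Hausdorff_PSU_diagonal: "Hausdorff_space PSU_diagonal_topology"
  unfolding homeomorphic_Hausdorff_space[OF homeomorphic_space_PSU_ratio]
  by (rule Hausdorff_space_subtopology) simp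

lemma second_countable_PSU_diagonal: "second_countable PSU_diagonal_topology"
  unfolding homeomorphic_space_second_countability[OF homeomorphic_space_PSU_ratio]
  by (rule second_countable_subtopology[OF second_countable_euclidean])

lemma PSU_diagonal_mult:
  "p \<in> PSU_diagonal \<Longrightarrow> q \<in> PSU_diagonal \<Longrightarrow> p \<otimes>\<^bsub>PSU\<^esub> q \<in> PSU_diagonal"
  by (rule subgroup.m_closed[OF subgroup_PSU_diagonal])

lemma PSU_diagonal_inv: "p \<in> PSU_diagonal \<Longrightarrow> inv\<^bsub>PSU\<^esub> p \<in> PSU_diagonal"
  by (rule subgroup.m_inv_closed[OF subgroup_PSU_diagonal])

text \<open>Diagonal entries of diagonal lifts multiply. Continuity and smoothness of multiplication
  and the homomorphism property of \<open>torus_coords\<close> all rest on this.\<close>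

lemma PSU_ratio_mult:
  assumes "p \<in> PSU_diagonal" "q \<in> PSU_diagonal"
  shows "PSU_ratio (p \<otimes>\<^bsub>PSU\<^esub> q) $ i $ j = PSU_ratio p $ i $ j * PSU_ratio q $ i $ j"
proof -
  obtain a where a: "p = PSU_proj (diag_matrix a)" "diag_matrix a \<in> SU_diagonal"
    using PSU_diagonalE[OF assms(1)] by blast
  obtain b where b: "q = PSU_proj (diag_matrix b)" "diag_matrix b \<in> SU_diagonal"
    using PSU_diagonalE[OF assms(2)] by blast
  have "diag_matrix (\<lambda>i. a i * b i) \<in> SU_diagonal"
    using SU_diagonal_mult[OF a(2) b(2)] by (simp add: diag_matrix_mult)
  then show ?thesis
    by (simp add: a b PSU_proj_diag_mult diag_matrix_mult PSU_ratio_diag)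
qed

lemma PSU_ratio_inv:
  assumes "p \<in> PSU_diagonal"
  shows "PSU_ratio (inv\<^bsub>PSU\<^esub> p) $ i $ j = cnj (PSU_ratio p $ i $ j)"
proof -
  obtain a where a: "p = PSU_proj (diag_matrix a)" "diag_matrix a \<in> SU_diagonal"
    using PSU_diagonalE[OF assms(1)] by blast
  have "inv\<^bsub>PSU\<^esub> p = PSU_proj (diag_matrix (\<lambda>i. cnj (a i)))"
    using PSU_proj_inv[of "diag_matrix a"] a SU_diagonal_subset by (auto simp: adjoint_diag_matrix)
  moreover have "diag_matrix (\<lambda>i. cnj (a i)) \<in> SU_diagonal"
    using SU_diagonal_adjoint[OF a(2)] by (simp add: adjoint_diag_matrix)
  ultimately show ?thesis
    by (simp add: a PSU_ratio_diag)
qed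

lemma continuous_map_PSU_diagonal_mult:
  "continuous_map (prod_topology PSU_diagonal_topology PSU_diagonal_topology)
     (PSU_diagonal_topology :: (complex^'n^'n) set topology) (\<lambda>(p, q). p \<otimes>\<^bsub>PSU\<^esub> q)"
proof (rule continuous_map_into_PSU_diagonal)
  let ?X = "prod_topology PSU_diagonal_topology PSU_diagonal_topology :: ((complex^'n^'n) set \<times> (complex^'n^'n) set) topology"
  have "continuous_map ?X (prod_topology euclidean euclidean) (\<lambda>z. (PSU_ratio (fst z), PSU_ratio (snd z)))"
    using continuous_map_compose[OF continuous_map_fst continuous_map_PSU_diagonal_ratio]
      continuous_map_compose[OF continuous_map_snd continuous_map_PSU_diagonal_ratio]
    by (intro continuous_map_pairedI) (simp_all add: comp_def)
  then have 1: "continuous_map ?X euclidean (\<lambda>z. (PSU_ratio (fst z), PSU_ratio (snd z)))"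
    unfolding prod_topology_euclidean .
  have "continuous_on UNIV (\<lambda>z :: (complex^'n^'n) \<times> (complex^'n^'n). \<chi> i j. fst z $ i $ j * snd z $ i $ j)"
    by (intro continuous_intros)
  then have 2: "continuous_map euclidean euclidean
      (\<lambda>z :: (complex^'n^'n) \<times> (complex^'n^'n). \<chi> i j. fst z $ i $ j * snd z $ i $ j)"
    by simp
  have "continuous_map ?X euclidean
      (\<lambda>z. \<chi> i j. PSU_ratio (fst z) $ i $ j * PSU_ratio (snd z) $ i $ j)"
    using continuous_map_compose[OF 1 2] by (simp add: comp_def)
  then show "continuous_map ?X euclidean (\<lambda>z. PSU_ratio (case z of (p, q) \<Rightarrow> p \<otimes>\<^bsub>PSU\<^esub> q))"
    by (rule continuous_map_eq)
      (auto simp: topspace_PSU_diagonal_topology PSU_ratio_mult vec_eq_iff simp del: topspace_subtopology)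
qed (auto simp: topspace_PSU_diagonal_topology PSU_diagonal_mult simp del: topspace_subtopology)

lemma continuous_map_PSU_diagonal_inv:
  "continuous_map PSU_diagonal_topology
     (PSU_diagonal_topology :: (complex^'n^'n) set topology) (\<lambda>p. inv\<^bsub>PSU\<^esub> p)"
proof (rule continuous_map_into_PSU_diagonal)
  have "continuous_map euclidean euclidean (\<lambda>z :: complex^'n^'n. \<chi> i j. cnj (z $ i $ j))"
    unfolding continuous_map_iff_continuous2 by (intro continuous_intros)
  from continuous_map_compose[OF continuous_map_PSU_diagonal_ratio this]
  have "continuous_map PSU_diagonal_topology euclidean
      (\<lambda>p :: (complex^'n^'n) set. \<chi> i j. cnj (PSU_ratio p $ i $ j))"
    by (simp add: comp_def)
  then show "continuous_map PSU_diagonal_topology euclidean (\<lambda>p :: (complex^'n^'n) set. PSU_ratio (inv\<^bsub>PSU\<^esub> p))"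
    by (rule continuous_map_eq)
      (auto simp: topspace_PSU_diagonal_topology PSU_ratio_inv vec_eq_iff simp del: topspace_subtopology)
qed (simp add: topspace_PSU_diagonal_topology PSU_diagonal_inv del: topspace_subtopology)

section \<open>Charts of the diagonal subgroup\<close>

text \<open>The Lie algebra of \<open>SU_diagonal\<close>, a real linear subspace. It is the common
  model space of all charts.\<close>

definition su_diagonal :: "(complex^'n^'n) set" where
  "su_diagonal = {X. (\<forall>i j. i \<noteq> j \<longrightarrow> X $ i $ j = 0) \<and> (\<forall>i. Re (X $ i $ i) = 0) \<and> (\<Sum>i\<in>UNIV. X $ i $ i) = 0}"

text \<open>Only differences are bounded, as only ratios are visible in \<open>PSU\<close>. Angles
  below pi/2 have exponentials with positive real part, and two such angles add up to less than pi,
  so principal logarithms can be added.\<close>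

definition diag_chart_domain :: "(complex^'n^'n) set" where
  "diag_chart_domain = {X \<in> su_diagonal. \<forall>i j. \<bar>Im (X $ i $ i) - Im (X $ j $ j)\<bar> < pi / 2}"

text \<open>The exponential map translated by \<open>A\<close>. It is smooth on the whole matrix
  space, so it is its own extension off \<open>su_diagonal\<close>.\<close>

definition diag_exp :: "complex^'n^'n \<Rightarrow> complex^'n^'n \<Rightarrow> complex^'n^'n" where
  "diag_exp A X = diag_matrix (\<lambda>i. A $ i $ i * exp (X $ i $ i))"

definition diag_param :: "complex^'n^'n \<Rightarrow> complex^'n^'n \<Rightarrow> (complex^'n^'n) set" where
  "diag_param A X = PSU_proj (diag_exp A X)"

text \<open>The inverse of the parametrisation: since the coordinates \<open>x\<^sub>i\<close> add up to \<open>0\<close>, they are the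
  row means of the logarithms \<open>x\<^sub>i - x\<^sub>j\<close> of the ratios.\<close>

definition diag_log :: "complex^'n^'n \<Rightarrow> complex^'n^'n \<Rightarrow> complex^'n^'n" where
  "diag_log A R = diag_matrix (\<lambda>i. (1 / of_nat CARD('n)) *
     (\<Sum>j\<in>UNIV. Ln (R $ i $ j * cnj (A $ i $ i) * A $ j $ j)))"

lemma subspace_su_diagonal: "subspace su_diagonal"
  unfolding subspace_def su_diagonal_def
  by (simp add: sum.distrib scaleR_sum_right[symmetric] del: scaleR_conv_of_real)

lemma diag_chart_domain_subset: "diag_chart_domain \<subseteq> su_diagonal"
  by (auto simp: diag_chart_domain_def)

lemma openin_diag_chart_domain:
  "openin (top_of_set su_diagonal) (diag_chart_domain :: (complex^'n^'n) set)"
proof -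
  let ?O = "\<Inter>i. \<Inter>j. {X :: complex^'n^'n. \<bar>Im (X $ i $ i) - Im (X $ j $ j)\<bar> < pi / 2}"
  have "open ?O"
    by (intro open_INT ballI open_Collect_less continuous_intros finite)
  moreover have "diag_chart_domain = su_diagonal \<inter> ?O"
    by (auto simp: diag_chart_domain_def)
  ultimately show ?thesis
    using openin_open_Int[of ?O su_diagonal] by (simp only:)
qed

lemma diag_entry_SU_diagonal:
  assumes "A \<in> SU_diagonal"
  shows "norm (A $ i $ i) = 1" "A $ i $ i * cnj (A $ i $ i) = 1"
    "(\<Prod>i\<in>UNIV. A $ i $ i) = 1"
proof -
  show n: "norm (A $ i $ i) = 1" "(\<Prod>i\<in>UNIV. A $ i $ i) = 1"
    using assms by (auto elim: SU_diagonalE)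
  show "A $ i $ i * cnj (A $ i $ i) = 1"
    using n by (simp only: mult_cnj_eq_1_iff)
qed

lemma diag_exp_in_SU_diagonal:
  assumes "A \<in> SU_diagonal" "X \<in> su_diagonal"
  shows "diag_exp A X \<in> SU_diagonal"
  unfolding diag_exp_def
proof (rule diag_matrix_in_SU_diagonal)
  show "norm (A $ i $ i * exp (X $ i $ i)) = 1" for i
    using assms by (simp add: norm_mult diag_entry_SU_diagonal su_diagonal_def)
  show "(\<Prod>i\<in>UNIV. A $ i $ i * exp (X $ i $ i)) = 1"
    using assms by (simp add: prod.distrib diag_entry_SU_diagonal exp_sum[symmetric] su_diagonal_def)
qed

lemma diag_param_in_PSU_diagonal:
  "A \<in> SU_diagonal \<Longrightarrow> X \<in> su_diagonal \<Longrightarrow> diag_param A X \<in> PSU_diagonal"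
  unfolding diag_param_def PSU_diagonal_def by (intro imageI diag_exp_in_SU_diagonal)

lemma PSU_ratio_diag_param:
  assumes "A \<in> SU_diagonal" "X \<in> su_diagonal"
  shows "PSU_ratio (diag_param A X) $ i $ j
    = (A $ i $ i * exp (X $ i $ i)) * cnj (A $ j $ j * exp (X $ j $ j))"
  using PSU_ratio_diag[of "\<lambda>i. A $ i $ i * exp (X $ i $ i)" i j] diag_exp_in_SU_diagonal[OF assms]
  by (simp add: diag_param_def diag_exp_def)

text \<open>The diagonal of X is imaginary, so conjugating an exponential inverts it; dividing by
  the ratio of \<open>A\<close> leaves the exponential of a difference.\<close>

lemma PSU_ratio_diag_param_quotient:
  assumes A: "A \<in> SU_diagonal" and X: "X \<in> su_diagonal"
  shows "PSU_ratio (diag_param A X) $ i $ j * cnj (A $ i $ i) * A $ j $ j = exp (X $ i $ i - X $ j $ j)"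
proof -
  have "cnj (X $ j $ j) = - (X $ j $ j)"
    using X by (simp add: su_diagonal_def complex_eq_iff)
  then have "cnj (exp (X $ j $ j)) = exp (- (X $ j $ j))"
    by (simp add: exp_cnj)
  then have "PSU_ratio (diag_param A X) $ i $ j * cnj (A $ i $ i) * A $ j $ j
      = (A $ i $ i * cnj (A $ i $ i)) * (A $ j $ j * cnj (A $ j $ j)) * (exp (X $ i $ i) * exp (- (X $ j $ j)))"
    by (simp add: PSU_ratio_diag_param[OF assms] mult_ac)
  then show ?thesis
    using diag_entry_SU_diagonal(2)[OF A] by (simp add: exp_add[symmetric])
qed

lemma diag_log_PSU_ratio:
  fixes A X :: "complex^'n^'n"
  assumes A: "A \<in> SU_diagonal" and X: "X \<in> diag_chart_domain"
  shows "diag_log A (PSU_ratio (diag_param A X)) = X"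
proof -
  have X': "X \<in> su_diagonal" using X diag_chart_domain_subset by blast
  have Ln: "Ln (exp (X $ i $ i - X $ j $ j)) = X $ i $ i - X $ j $ j" for i j
  proof (rule Ln_exp)
    have "\<bar>Im (X $ i $ i) - Im (X $ j $ j)\<bar> < pi / 2"
      using X by (simp add: diag_chart_domain_def)
    then show "- pi < Im (X $ i $ i - X $ j $ j)" "Im (X $ i $ i - X $ j $ j) \<le> pi"
      unfolding minus_complex.sel using pi_gt_zero by linarith+
  qed
  have off: "X $ i $ j = 0" if "i \<noteq> j" for i j
    using X' that by (simp add: su_diagonal_def)
  have sum0: "(\<Sum>j\<in>UNIV. X $ j $ j) = 0"
    using X' by (simp add: su_diagonal_def)
  have "(\<Sum>j\<in>UNIV. Ln (PSU_ratio (diag_param A X) $ i $ j * cnj (A $ i $ i) * A $ j $ j))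
      = of_nat CARD('n) * X $ i $ i" for i
    unfolding PSU_ratio_diag_param_quotient[OF A X'] Ln sum_subtractf sum0 by simp
  then have "diag_log A (PSU_ratio (diag_param A X)) $ i $ j = X $ i $ j" for i j
    by (cases "i = j") (simp_all add: diag_log_def off)
  then show ?thesis
    by (simp add: vec_eq_iff)
qed

text \<open>The logarithms \<theta> form an additive cocycle, hence \<theta> i j = y i - y j with y
  the row means. These y lie in the chart domain and reproduce the ratios of p, and injectivity of
  \<open>PSU_ratio\<close> gives p itself.\<close>

lemma diag_log_right_inverse:
  fixes A :: "complex^'n^'n"
  assumes A: "A \<in> SU_diagonal" and p: "p \<in> PSU_diagonal"
    and pos: "\<And>i j. 0 < Re (PSU_ratio p $ i $ j * cnj (A $ i $ i) * A $ j $ j)"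
  shows "diag_log A (PSU_ratio p) \<in> diag_chart_domain"
    and "diag_param A (diag_log A (PSU_ratio p)) = p"
proof -
  obtain a where a: "p = PSU_proj (diag_matrix a)" "diag_matrix a \<in> SU_diagonal" "\<And>i. norm (a i) = 1"
    using PSU_diagonalE[OF p] by blast
  define e where "e i = a i * cnj (A $ i $ i)" for i
  have e: "e i * cnj (e i) = 1" for i
    unfolding mult_cnj_eq_1_iff by (simp add: e_def norm_mult a(3) diag_entry_SU_diagonal[OF A])
  define c where "c i j = PSU_ratio p $ i $ j * cnj (A $ i $ i) * A $ j $ j" for i j
  have c: "c i j = e i * cnj (e j)" for i j
    by (simp add: c_def e_def a(1) PSU_ratio_diag[OF a(2)] mult_ac)
  define \<theta> where "\<theta> i j = Ln (c i j)" for i j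
  have c0: "c i j \<noteq> 0" for i j
    using pos[of i j] by (auto simp: c_def)
  have exp_\<theta>: "exp (\<theta> i j) = c i j" for i j
    by (simp add: \<theta>_def c0)
  have norm_c: "norm (c i j) = 1" for i j
    using e mult_cnj_eq_1_iff by (simp add: c norm_mult)
  have Re_\<theta>: "Re (\<theta> i j) = 0" for i j
    by (simp add: \<theta>_def c0 norm_c)
  have Im_\<theta>: "\<bar>Im (\<theta> i j)\<bar> < pi / 2" for i j
    unfolding \<theta>_def by (rule Re_Ln_pos_lt_imp) (use pos in \<open>simp add: c_def\<close>)
  have add: "\<theta> i k = \<theta> i j + \<theta> j k" for i j k
  proof -
    have "c i k = (e i * cnj (e k)) * (e j * cnj (e j))"
      by (simp add: c e)
    also have "\<dots> = c i j * c j k"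
      by (simp add: c mult_ac)
    finally have "c i k = exp (\<theta> i j + \<theta> j k)"
      by (simp add: exp_add exp_\<theta>)
    moreover have "Ln (exp (\<theta> i j + \<theta> j k)) = \<theta> i j + \<theta> j k"
      \<comment> \<open>Two imaginary parts below pi/2 in modulus add up to less than pi, so no
        multiple of 2 pi i intervenes.\<close>
      by (rule Ln_exp; unfold plus_complex.sel; use Im_\<theta>[of i j] Im_\<theta>[of j k] in linarith)
    ultimately show ?thesis
      by (simp add: \<theta>_def)
  qed
  have \<theta>_refl: "\<theta> i i = 0" for i
    using add[of i i i] by simp
  have \<theta>_swap: "\<theta> j i = - \<theta> i j" for i j
    using add[of i i j] \<theta>_refl by (simp add: eq_neg_iff_add_eq_0 add.commute)
  define y where "y i = (1 / of_nat CARD('n)) * (\<Sum>j\<in>UNIV. \<theta> i j)" for i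
  have log: "diag_log A (PSU_ratio p) = diag_matrix y"
    by (simp add: diag_log_def y_def[abs_def] \<theta>_def c_def)
  have y_diff: "y i - y j = \<theta> i j" for i j
  proof -
    have "y i - y j = (1 / of_nat CARD('n)) * (\<Sum>k\<in>UNIV. \<theta> i k - \<theta> j k)"
      by (simp add: y_def sum_subtractf right_diff_distrib)
    \<comment> \<open>By additivity the summand does not depend on k, so the average equals
      it.\<close>
    also have "(\<lambda>k. \<theta> i k - \<theta> j k) = (\<lambda>k. \<theta> i j)"
      using add[of i _ j] by (intro ext) (metis add_diff_cancel_right')
    finally show ?thesis by simp
  qed
  \<comment> \<open>Antisymmetry makes the double sum equal to its negative; this is the trace
    condition in \<open>su_diagonal\<close>.\<close>
  have "(\<Sum>i\<in>UNIV. \<Sum>j\<in>UNIV. \<theta> i j) = (\<Sum>i\<in>UNIV. \<Sum>j\<in>UNIV. \<theta> j i)"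
    by (rule sum.swap)
  also have "\<dots> = (\<Sum>i\<in>UNIV. \<Sum>j\<in>UNIV. - \<theta> i j)"
    by (intro sum.cong refl \<theta>_swap)
  also have "\<dots> = - (\<Sum>i\<in>UNIV. \<Sum>j\<in>UNIV. \<theta> i j)"
    by (simp add: sum_negf)
  finally have "(\<Sum>i\<in>UNIV. \<Sum>j\<in>UNIV. \<theta> i j) = 0"
    by simp
  then have "(\<Sum>i\<in>UNIV. y i) = 0"
    by (simp only: y_def sum_distrib_left[symmetric]) simp
  moreover have "Re (y i) = 0" for i
  proof -
    have "y i = (\<Sum>j\<in>UNIV. \<theta> i j) / of_nat CARD('n)"
      by (simp add: y_def)
    then show ?thesis
      by (simp only: Re_divide_of_nat Re_sum Re_\<theta>) simp
  qed
  ultimately have y: "diag_matrix y \<in> su_diagonal"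
    by (simp add: su_diagonal_def)
  have "\<bar>Im (y i) - Im (y j)\<bar> < pi / 2" for i j
    using Im_\<theta>[of i j] by (simp add: y_diff[symmetric])
  then show "diag_log A (PSU_ratio p) \<in> diag_chart_domain"
    using y by (simp add: log diag_chart_domain_def)
  have "PSU_ratio (diag_param A (diag_matrix y)) $ i $ j = PSU_ratio p $ i $ j" for i j
  proof -
    have "PSU_ratio (diag_param A (diag_matrix y)) $ i $ j * cnj (A $ i $ i) * A $ j $ j
        = PSU_ratio p $ i $ j * cnj (A $ i $ i) * A $ j $ j"
      by (simp add: PSU_ratio_diag_param_quotient[OF A y] y_diff exp_\<theta> c_def)
    moreover have "cnj (A $ i $ i) \<noteq> 0" "A $ j $ j \<noteq> 0"
      using diag_entry_SU_diagonal(1)[OF A] by (metis complex_cnj_zero_iff norm_zero zero_neq_one)+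
    ultimately show ?thesis by simp
  qed
  then have "PSU_ratio (diag_param A (diag_matrix y)) = PSU_ratio p"
    by (simp add: vec_eq_iff)
  then show "diag_param A (diag_log A (PSU_ratio p)) = p"
    unfolding log by (rule inj_onD[OF inj_on_PSU_ratio _ diag_param_in_PSU_diagonal[OF A y] p])
qed

lemma inj_on_diag_param: "A \<in> SU_diagonal \<Longrightarrow> inj_on (diag_param A) diag_chart_domain"
  by (rule inj_on_inverseI[where g = "\<lambda>p. diag_log A (PSU_ratio p)"]) (rule diag_log_PSU_ratio)

text \<open>Strict inequalities for continuous functions describe the image, whence its openness.
  The same inequalities cut out the open set on which \<open>diag_log\<close> is smooth.\<close>

lemma image_diag_param:
  assumes A: "A \<in> SU_diagonal"
  shows "diag_param A ` diag_chart_domain =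
    {p \<in> PSU_diagonal. \<forall>i j. 0 < Re (PSU_ratio p $ i $ j * cnj (A $ i $ i) * A $ j $ j)}"
proof (intro antisym subsetI)
  fix p assume "p \<in> diag_param A ` diag_chart_domain"
  then obtain X where X: "X \<in> diag_chart_domain" "p = diag_param A X" by blast
  then have X': "X \<in> su_diagonal" using diag_chart_domain_subset by blast
  have "0 < Re (PSU_ratio p $ i $ j * cnj (A $ i $ i) * A $ j $ j)" for i j
  proof -
    have "\<bar>Im (X $ i $ i) - Im (X $ j $ j)\<bar> < pi / 2"
      using X(1) by (simp add: diag_chart_domain_def)
    then have "0 < cos (Im (X $ i $ i) - Im (X $ j $ j))"
      by (intro cos_gt_zero_pi) linarith+
    then show ?thesis
      by (simp add: X(2) PSU_ratio_diag_param_quotient[OF A X'] Re_exp)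
  qed
  then show "p \<in> {p \<in> PSU_diagonal. \<forall>i j. 0 < Re (PSU_ratio p $ i $ j * cnj (A $ i $ i) * A $ j $ j)}"
    using diag_param_in_PSU_diagonal[OF A X'] X(2) by simp
next
  fix p assume "p \<in> {p \<in> PSU_diagonal. \<forall>i j. 0 < Re (PSU_ratio p $ i $ j * cnj (A $ i $ i) * A $ j $ j)}"
  then show "p \<in> diag_param A ` diag_chart_domain"
    using diag_log_right_inverse[OF A, of p] by (metis (no_types, lifting) image_eqI mem_Collect_eq)
qed

lemma inv_into_diag_param:
  assumes "A \<in> SU_diagonal" "p \<in> diag_param A ` diag_chart_domain"
  shows "inv_into diag_chart_domain (diag_param A) p = diag_log A (PSU_ratio p)"
  using assms(2) inv_into_f_f[OF inj_on_diag_param[OF assms(1)]] diag_log_PSU_ratio[OF assms(1)] by auto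

section \<open>Smoothness in the charts\<close>

lemma C_infinity_diag_matrix:
  assumes "open W" "\<And>i. C_infinity (f i) W"
  shows "C_infinity (\<lambda>x. diag_matrix (\<lambda>i. f i x :: complex)) W"
proof -
  have "C_infinity (\<lambda>x. if i = j then f i x else 0) W" for i j
    by (cases "i = j") (simp_all add: assms C_infinity_const)
  then show ?thesis
    unfolding diag_matrix_def by (intro C_infinity_vec assms)
qed

lemma open_pos_ratio:
  fixes A :: "complex^'n^'n" and r :: "'a::topological_space \<Rightarrow> complex^'n^'n"
  assumes "\<And>i j. continuous_on UNIV (\<lambda>x. r x $ i $ j)"
  shows "open {x. \<forall>i j. 0 < Re (r x $ i $ j * cnj (A $ i $ i) * A $ j $ j)}"
proof -
  have "open (\<Inter>i. \<Inter>j. {x. 0 < Re (r x $ i $ j * cnj (A $ i $ i) * A $ j $ j)})"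
    by (intro open_INT ballI open_Collect_less continuous_intros assms finite)
  also have "(\<Inter>i. \<Inter>j. {x. 0 < Re (r x $ i $ j * cnj (A $ i $ i) * A $ j $ j)})
      = {x. \<forall>i j. 0 < Re (r x $ i $ j * cnj (A $ i $ i) * A $ j $ j)}"
    by blast
  finally show ?thesis .
qed

lemma C_infinity_diag_log:
  fixes A :: "complex^'n^'n"
  assumes "open W" "\<And>i j. C_infinity (\<lambda>x. r x $ i $ j) W"
    and "\<And>x i j. x \<in> W \<Longrightarrow> 0 < Re (r x $ i $ j * cnj (A $ i $ i) * A $ j $ j)"
  shows "C_infinity (\<lambda>x. diag_log A (r x)) W"
  unfolding diag_log_def
  by (intro C_infinity_diag_matrix C_infinity_mult C_infinity_sum C_infinity_const C_infinity_Ln assms)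

text \<open>The common reason why transition maps, products and inverses are smooth: each lands in a
  chart and has as ratios a_i times the conjugate of a_j, where the a_i are smooth on the whole
  space. Inserting these products into \<open>diag_log\<close> gives one extension on an open set
  that contains \<open>S\<close>.\<close>

lemma smooth_map_on_inv_diag_param:
  fixes A :: "complex^'n^'n" and g :: "'a::real_normed_vector \<Rightarrow> (complex^'n^'n) set"
  assumes A: "A \<in> SU_diagonal" and a: "\<And>i. C_infinity (a i) UNIV"
    and g: "\<And>x. x \<in> S \<Longrightarrow> g x \<in> diag_param A ` diag_chart_domain"
    and ratio: "\<And>x i j. x \<in> S \<Longrightarrow> PSU_ratio (g x) $ i $ j = a i x * cnj (a j x)"
    and f: "\<And>x. x \<in> S \<Longrightarrow> f x = inv_into diag_chart_domain (diag_param A) (g x)"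
  shows "smooth_map_on S f"
proof -
  define r :: "'a \<Rightarrow> complex^'n^'n" where "r x = (\<chi> i j. a i x * cnj (a j x))" for x
  define W where "W = {x. \<forall>i j. 0 < Re (r x $ i $ j * cnj (A $ i $ i) * A $ j $ j)}"
  have cont: "continuous_on UNIV (a i)" for i
    using C_infinity_imp_continuous_on[OF a] .
  have W: "open W"
    unfolding W_def by (rule open_pos_ratio) (simp add: r_def continuous_intros cont)
  have aW: "C_infinity (a i) W" for i
    using C_infinity_subset[OF a] by simp
  have "C_infinity (\<lambda>x. r x $ i $ j) W" for i j
    by (simp add: r_def C_infinity_mult C_infinity_cnj W aW)
  then have "C_infinity (\<lambda>x. diag_log A (r x)) W"
    by (rule C_infinity_diag_log[OF W]) (simp add: W_def)
  moreover have "S \<subseteq> W" "\<forall>x\<in>S. f x = diag_log A (r x)"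
  proof -
    have r: "PSU_ratio (g x) = r x" if "x \<in> S" for x
      by (simp add: vec_eq_iff r_def ratio[OF that])
    show "S \<subseteq> W"
      using g r unfolding image_diag_param[OF A] W_def by auto
    show "\<forall>x\<in>S. f x = diag_log A (r x)"
      using f g r inv_into_diag_param[OF A] by simp
  qed
  ultimately show ?thesis
    unfolding smooth_map_on_def using W by blast
qed

lemma has_derivative_vec_lambda:
  fixes f :: "'i::finite \<Rightarrow> 'a::real_normed_vector \<Rightarrow> 'b::real_normed_vector"
  assumes "\<And>i. (f i has_derivative f' i) F"
  shows "((\<lambda>x. \<chi> i. f i x) has_derivative (\<lambda>h. \<chi> i. f' i h)) F"
proof -
  have "((\<lambda>x. \<Sum>i\<in>UNIV. axis i (f i x)) has_derivative (\<lambda>h. \<Sum>i\<in>UNIV. axis i (f' i h))) F"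
    by (intro has_derivative_sum bounded_linear.has_derivative[OF bounded_linear_axis] assms)
  moreover have "(\<Sum>i\<in>UNIV. axis i (g i)) = (\<chi> i. g i)" for g :: "'i \<Rightarrow> 'b"
    by (simp add: vec_eq_iff axis_def if_distrib[of "\<lambda>z. z = _"] cong: if_cong)
  ultimately show ?thesis by simp
qed

lemma has_derivative_diag_exp:
  "(diag_exp A has_derivative (\<lambda>H. diag_matrix (\<lambda>i. A $ i $ i * (exp (X $ i $ i) * H $ i $ i)))) (at X)"
proof -
  have "((\<lambda>X. A $ i $ i * exp (X $ i $ i)) has_derivative
      (\<lambda>H. A $ i $ i * (exp (X $ i $ i) * H $ i $ i))) (at X)" for i
  proof -
    have "((\<lambda>X. X $ i $ i) has_derivative (\<lambda>H. H $ i $ i)) (at X)"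
      by (rule bounded_linear_imp_has_derivative
          [OF bounded_linear_compose[OF bounded_linear_vec_nth bounded_linear_vec_nth]])
    then have "((\<lambda>X. exp (X $ i $ i)) has_derivative (\<lambda>H. exp (X $ i $ i) * H $ i $ i)) (at X)"
      by (rule has_derivative_compose[OF _ DERIV_exp[unfolded has_field_derivative_def]])
    then show ?thesis
      by (rule has_derivative_mult_right)
  qed
  then have "((\<lambda>X. if i = j then A $ i $ i * exp (X $ i $ i) else 0) has_derivative
      (\<lambda>H. if i = j then A $ i $ i * (exp (X $ i $ i) * H $ i $ i) else 0)) (at X)" for i j
    by (cases "i = j") simp_all
  then show ?thesis
    unfolding diag_exp_def[abs_def] diag_matrix_def by (intro has_derivative_vec_lambda)
qed

lemma C_infinity_diag_exp:
  assumes "open W"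
  shows "C_infinity (diag_exp A) W"
  unfolding diag_exp_def[abs_def]
  by (intro C_infinity_diag_matrix C_infinity_mult C_infinity_const C_infinity_exp assms
      C_infinity_bounded_linear bounded_linear_compose[OF bounded_linear_vec_nth bounded_linear_vec_nth])

text \<open>On the diagonal the derivative multiplies by the nonzero numbers A_ii exp(X_ii). It
  ignores the entries off the diagonal, and these vanish on \<open>su_diagonal\<close>.\<close>

lemma immersion_diag_param:
  fixes A :: "complex^'n^'n"
  assumes A: "A \<in> SU_diagonal"
  shows "immersion_into_PSU su_diagonal diag_chart_domain (diag_param A)"
  unfolding immersion_into_PSU_def
proof (intro ballI exI conjI)
  fix X :: "complex^'n^'n" assume "X \<in> diag_chart_domain"
  have "diag_exp A Y \<in> carrier SU" if "Y \<in> diag_chart_domain" for Y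
    using diag_exp_in_SU_diagonal[OF A, of Y] that diag_chart_domain_subset SU_diagonal_subset by blast
  then show "smooth_lift_at diag_chart_domain (diag_param A) X (diag_exp A)"
    unfolding smooth_lift_at_def
    by (intro exI[of _ UNIV]) (auto simp: C_infinity_diag_exp diag_param_def)
  have "frechet_derivative (diag_exp A) (at X)
      = (\<lambda>H. diag_matrix (\<lambda>i. A $ i $ i * (exp (X $ i $ i) * H $ i $ i)))"
    by (rule frechet_derivative_at[OF has_derivative_diag_exp, symmetric])
  moreover have "A $ i $ i \<noteq> 0" for i
    using diag_entry_SU_diagonal(1)[OF A] by (metis norm_zero zero_neq_one)
  ultimately show "inj_on (frechet_derivative (diag_exp A) (at X)) su_diagonal"
    by (auto simp: inj_on_def vec_eq_iff su_diagonal_def) (metis)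
qed

lemma continuous_map_diag_log:
  assumes "A \<in> SU_diagonal"
  shows "continuous_map (subtopology PSU_diagonal_topology (diag_param A ` diag_chart_domain))
    (top_of_set diag_chart_domain) (\<lambda>p :: (complex^'n^'n) set. diag_log A (PSU_ratio p))"
proof -
  define W where "W = {R :: complex^'n^'n. \<forall>i j. 0 < Re (R $ i $ j * cnj (A $ i $ i) * A $ j $ j)}"
  have W: "open W"
    unfolding W_def by (rule open_pos_ratio) (intro continuous_intros)
  have "C_infinity (\<lambda>R. diag_log A R) W"
    by (rule C_infinity_diag_log[OF W C_infinity_bounded_linear[OF
            bounded_linear_compose[OF bounded_linear_vec_nth bounded_linear_vec_nth] W]])
      (simp add: W_def)
  then have "continuous_map (top_of_set W) euclidean (diag_log A)"
    using C_infinity_imp_continuous_on by auto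
  moreover have "continuous_map (subtopology PSU_diagonal_topology (diag_param A ` diag_chart_domain))
      (top_of_set W) (PSU_ratio :: (complex^'n^'n) set \<Rightarrow> _)"
    unfolding continuous_map_in_subtopology
    using continuous_map_from_subtopology[OF continuous_map_PSU_diagonal_ratio]
    by (auto simp: image_diag_param[OF assms] W_def simp del: subtopology_subtopology)
  ultimately have "continuous_map (subtopology PSU_diagonal_topology (diag_param A ` diag_chart_domain))
      euclidean (diag_log A \<circ> (PSU_ratio :: (complex^'n^'n) set \<Rightarrow> _))"
    by (rule continuous_map_compose[rotated])
  then show ?thesis
    unfolding continuous_map_in_subtopology comp_def
    by (auto simp: diag_log_PSU_ratio[OF assms])
qed

lemma continuous_map_diag_param:
  assumes "A \<in> SU_diagonal"
  shows "continuous_map (top_of_set diag_chart_domain) PSU_diagonal_topology (diag_param A)"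
proof (rule continuous_map_into_PSU_diagonal)
  have "continuous_map (top_of_set diag_chart_domain) PSU_topology (diag_param A)"
    unfolding diag_param_def[abs_def]
  proof (rule continuous_map_PSU_proj_comp)
    show "continuous_on diag_chart_domain (diag_exp A)"
      using C_infinity_imp_continuous_on[OF C_infinity_diag_exp[OF open_UNIV]] continuous_on_subset by blast
    show "diag_exp A ` diag_chart_domain \<subseteq> carrier SU"
      using diag_exp_in_SU_diagonal[OF assms] diag_chart_domain_subset SU_diagonal_subset by blast
  qed
  from continuous_map_compose[OF this continuous_map_PSU_ratio]
  show "continuous_map (top_of_set diag_chart_domain) euclidean (\<lambda>X. PSU_ratio (diag_param A X))"
    by (simp add: comp_def)
qed (use diag_param_in_PSU_diagonal[OF assms] diag_chart_domain_subset in auto)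

lemma homeomorphic_map_diag_param:
  assumes "A \<in> SU_diagonal"
  shows "homeomorphic_map (top_of_set diag_chart_domain)
    (subtopology PSU_diagonal_topology (diag_param A ` diag_chart_domain)) (diag_param A)"
proof (rule homeomorphic_maps_imp_map)
  show "homeomorphic_maps (top_of_set diag_chart_domain)
    (subtopology PSU_diagonal_topology (diag_param A ` diag_chart_domain)) (diag_param A)
    (\<lambda>p. diag_log A (PSU_ratio p))"
    unfolding homeomorphic_maps_def
    using continuous_map_diag_param[OF assms] continuous_map_diag_log[OF assms]
    by (auto simp: continuous_map_in_subtopology diag_log_PSU_ratio[OF assms])
qed

lemma openin_image_diag_param:
  fixes A :: "complex^'n^'n"
  assumes "A \<in> SU_diagonal"
  shows "openin PSU_diagonal_topology (diag_param A ` diag_chart_domain)"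
proof -
  have "open {R :: complex^'n^'n. \<forall>i j. 0 < Re (R $ i $ j * cnj (A $ i $ i) * A $ j $ j)}"
    by (rule open_pos_ratio) (intro continuous_intros)
  then have "openin PSU_diagonal_topology {p \<in> topspace PSU_diagonal_topology. PSU_ratio p \<in>
      {R :: complex^'n^'n. \<forall>i j. 0 < Re (R $ i $ j * cnj (A $ i $ i) * A $ j $ j)}}"
    by (intro openin_continuous_map_preimage[OF continuous_map_PSU_diagonal_ratio]) simp
  then show ?thesis
    unfolding topspace_PSU_diagonal_topology image_diag_param[OF assms] by simp
qed

text \<open>One translated chart for each diagonal matrix, so that every point is the image of X = 0
  in some chart.\<close>

definition diag_params :: "'n::finite param set" where
  "diag_params = (\<lambda>A. (diag_chart_domain, diag_param A)) ` SU_diagonal"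

lemma immersed_submanifold_PSU_diagonal:
  "immersed_submanifold (PSU_diagonal_topology :: (complex^'n^'n) set topology) su_diagonal diag_params"
  unfolding immersed_submanifold_def
proof (intro conjI)
  show "Hausdorff_space (PSU_diagonal_topology :: (complex^'n^'n) set topology)"
    by (rule Hausdorff_PSU_diagonal)
  show "second_countable (PSU_diagonal_topology :: (complex^'n^'n) set topology)"
    by (rule second_countable_PSU_diagonal)
  show "subspace (su_diagonal :: (complex^'n^'n) set)"
    by (rule subspace_su_diagonal)
  have "p \<in> (\<Union>A\<in>SU_diagonal. diag_param A ` diag_chart_domain)" if p: "p \<in> PSU_diagonal" for p :: "(complex^'n^'n) set"
  proof -
    obtain a where a: "p = PSU_proj (diag_matrix a)" "diag_matrix a \<in> SU_diagonal"
      using PSU_diagonalE[OF p] by blast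
    have "p = diag_param (diag_matrix a) 0"
      by (simp add: a(1) diag_param_def diag_exp_def)
    moreover have "(0 :: complex^'n^'n) \<in> diag_chart_domain"
      by (simp add: diag_chart_domain_def su_diagonal_def)
    ultimately show ?thesis
      using a(2) by blast
  qed
  then show "topspace (PSU_diagonal_topology :: (complex^'n^'n) set topology) = (\<Union>(U, \<psi>)\<in>diag_params. \<psi> ` U)"
    unfolding topspace_PSU_diagonal_topology diag_params_def
    using diag_param_in_PSU_diagonal diag_chart_domain_subset by fastforce
  show "\<forall>(U, \<psi>)\<in>diag_params. openin (top_of_set su_diagonal) U \<and>
      openin (PSU_diagonal_topology :: (complex^'n^'n) set topology) (\<psi> ` U) \<and>
      homeomorphic_map (top_of_set U) (subtopology PSU_diagonal_topology (\<psi> ` U)) \<psi> \<and>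
      immersion_into_PSU su_diagonal U \<psi>"
    by (auto simp: diag_params_def openin_diag_chart_domain openin_image_diag_param
        homeomorphic_map_diag_param immersion_diag_param simp del: subtopology_subtopology)
  have "smooth_map_on {X \<in> diag_chart_domain. diag_param A X \<in> diag_param B ` diag_chart_domain}
      (\<lambda>X. inv_into diag_chart_domain (diag_param B) (diag_param A X))"
    if A: "A \<in> SU_diagonal" and B: "B \<in> SU_diagonal" for A B :: "complex^'n^'n"
  proof (rule smooth_map_on_inv_diag_param[OF B, where a = "\<lambda>i X. A $ i $ i * exp (X $ i $ i)" and g = "diag_param A"])
    show "C_infinity (\<lambda>X :: complex^'n^'n. A $ i $ i * exp (X $ i $ i)) UNIV" for i
      by (intro C_infinity_mult C_infinity_const C_infinity_exp open_UNIV
      C_infinity_bounded_linear bounded_linear_compose[OF bounded_linear_vec_nth bounded_linear_vec_nth])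
  qed (use PSU_ratio_diag_param[OF A] diag_chart_domain_subset in blast)+
  then show "\<forall>(U, \<psi>)\<in>diag_params. \<forall>(U', \<psi>')\<in>diag_params :: 'n param set.
      smooth_map_on {x \<in> U. \<psi> x \<in> \<psi>' ` U'} (\<lambda>x. inv_into U' \<psi>' (\<psi> x))"
    by (auto simp: diag_params_def)
qed

lemma smooth_group_operations_PSU_diagonal:
  "smooth_group_operations (PSU_diagonal_topology :: (complex^'n^'n) set topology) diag_params"
  unfolding smooth_group_operations_def
proof (intro conjI continuous_map_PSU_diagonal_mult continuous_map_PSU_diagonal_inv)
  have lin: "C_infinity (\<lambda>X :: complex^'n^'n. A $ i $ i * exp (X $ i $ i)) UNIV" for A :: "complex^'n^'n" and i
    by (intro C_infinity_mult C_infinity_const C_infinity_exp open_UNIV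
      C_infinity_bounded_linear bounded_linear_compose[OF bounded_linear_vec_nth bounded_linear_vec_nth])
  have "smooth_map_on {(X, Y) \<in> diag_chart_domain \<times> diag_chart_domain.
        diag_param A X \<otimes>\<^bsub>PSU\<^esub> diag_param B Y \<in> diag_param C ` diag_chart_domain}
      (\<lambda>(X, Y). inv_into diag_chart_domain (diag_param C) (diag_param A X \<otimes>\<^bsub>PSU\<^esub> diag_param B Y))"
    if A: "A \<in> SU_diagonal" and B: "B \<in> SU_diagonal" and C: "C \<in> SU_diagonal" for A B C :: "complex^'n^'n"
  \<comment> \<open>The functions \<open>a\<close> are the diagonal entries of the product of the
    lifts \<open>diag_exp A\<close> and \<open>diag_exp B\<close>.\<close>
  proof (rule smooth_map_on_inv_diag_param[OF C,
        where a = "\<lambda>i z. (A $ i $ i * exp (fst z $ i $ i)) * (B $ i $ i * exp (snd z $ i $ i))"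
          and g = "\<lambda>z. diag_param A (fst z) \<otimes>\<^bsub>PSU\<^esub> diag_param B (snd z)"])
    show "C_infinity (\<lambda>z :: (complex^'n^'n) \<times> (complex^'n^'n).
        (A $ i $ i * exp (fst z $ i $ i)) * (B $ i $ i * exp (snd z $ i $ i))) UNIV" for i
      by (intro C_infinity_mult C_infinity_const C_infinity_exp open_UNIV C_infinity_bounded_linear
          bounded_linear_compose[OF bounded_linear_vec_nth]
          bounded_linear_compose[OF bounded_linear_vec_nth bounded_linear_fst]
          bounded_linear_compose[OF bounded_linear_vec_nth bounded_linear_snd])
    show "PSU_ratio (diag_param A (fst z) \<otimes>\<^bsub>PSU\<^esub> diag_param B (snd z)) $ i $ j =
        (A $ i $ i * exp (fst z $ i $ i)) * (B $ i $ i * exp (snd z $ i $ i)) *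
        cnj ((A $ j $ j * exp (fst z $ j $ j)) * (B $ j $ j * exp (snd z $ j $ j)))"
      if "z \<in> {(X, Y) \<in> diag_chart_domain \<times> diag_chart_domain.
        diag_param A X \<otimes>\<^bsub>PSU\<^esub> diag_param B Y \<in> diag_param C ` diag_chart_domain}" for z i j
    proof -
      have "fst z \<in> su_diagonal" "snd z \<in> su_diagonal"
        using that diag_chart_domain_subset by auto
      then show ?thesis
        by (simp add: PSU_ratio_mult diag_param_in_PSU_diagonal PSU_ratio_diag_param A B mult_ac)
    qed
  qed auto
  then show "\<forall>(U1, \<psi>1)\<in>diag_params. \<forall>(U2, \<psi>2)\<in>diag_params. \<forall>(U3, \<psi>3)\<in>diag_params :: 'n param set.
      smooth_map_on {(x, y) \<in> U1 \<times> U2. \<psi>1 x \<otimes>\<^bsub>PSU\<^esub> \<psi>2 y \<in> \<psi>3 ` U3}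
          (\<lambda>(x, y). inv_into U3 \<psi>3 (\<psi>1 x \<otimes>\<^bsub>PSU\<^esub> \<psi>2 y))"
    by (simp add: diag_params_def)
  have "smooth_map_on {X \<in> diag_chart_domain. inv\<^bsub>PSU\<^esub> diag_param A X \<in> diag_param B ` diag_chart_domain}
      (\<lambda>X. inv_into diag_chart_domain (diag_param B) (inv\<^bsub>PSU\<^esub> diag_param A X))"
    if A: "A \<in> SU_diagonal" and B: "B \<in> SU_diagonal" for A B :: "complex^'n^'n"
  proof (rule smooth_map_on_inv_diag_param[OF B, where a = "\<lambda>i X. cnj (A $ i $ i * exp (X $ i $ i))"
          and g = "\<lambda>X. inv\<^bsub>PSU\<^esub> diag_param A X"])
    show "C_infinity (\<lambda>X :: complex^'n^'n. cnj (A $ i $ i * exp (X $ i $ i))) UNIV" for i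
      by (intro C_infinity_cnj lin open_UNIV)
    show "PSU_ratio (inv\<^bsub>PSU\<^esub> diag_param A X) $ i $ j =
        cnj (A $ i $ i * exp (X $ i $ i)) * cnj (cnj (A $ j $ j * exp (X $ j $ j)))"
      if "X \<in> {X \<in> diag_chart_domain. inv\<^bsub>PSU\<^esub> diag_param A X \<in> diag_param B ` diag_chart_domain}" for X i j
    proof -
      have "X \<in> su_diagonal"
        using that diag_chart_domain_subset by auto
      then show ?thesis
        by (simp add: PSU_ratio_inv diag_param_in_PSU_diagonal PSU_ratio_diag_param A)
    qed
  qed auto
  then show "\<forall>(U1, \<psi>1)\<in>diag_params. \<forall>(U2, \<psi>2)\<in>diag_params :: 'n param set.
      smooth_map_on {x \<in> U1. inv\<^bsub>PSU\<^esub> (\<psi>1 x) \<in> \<psi>2 ` U2}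
          (\<lambda>x. inv_into U2 \<psi>2 (inv\<^bsub>PSU\<^esub> (\<psi>1 x)))"
    by (simp add: diag_params_def)
qed

lemma Lie_subgroup_PSU_diagonal: "Lie_subgroup PSU_diagonal PSU_diagonal_topology"
  unfolding Lie_subgroup_def
  using subgroup_PSU_diagonal topspace_PSU_diagonal_topology immersed_submanifold_PSU_diagonal
    smooth_group_operations_PSU_diagonal by blast

section \<open>The isomorphism with the torus\<close>

lemma carrier_torus: "carrier torus = {z. \<forall>i. norm (z $ i) = 1}"
  and mult_torus: "z \<otimes>\<^bsub>torus\<^esub> w = (\<chi> i. z $ i * w $ i)"
  by (simp_all add: torus_def)

definition torus_coords :: "('m \<Rightarrow> 'n) \<Rightarrow> 'n \<Rightarrow> (complex^'n^'n) set \<Rightarrow> complex^'m" where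
  "torus_coords e i\<^sub>0 p = (\<chi> m. PSU_ratio p $ e m $ i\<^sub>0)"

text \<open>The diagonal of a unitary matrix with prescribed ratios to the entry at
  \<open>i\<^sub>0\<close>, which is normalised to 1. Its determinant still has to be
  corrected.\<close>

definition torus_extend :: "('m \<Rightarrow> 'n) \<Rightarrow> 'n \<Rightarrow> complex^'m \<Rightarrow> 'n \<Rightarrow> complex" where
  "torus_extend e i\<^sub>0 z i = (if i = i\<^sub>0 then 1 else z $ inv_into UNIV e i)"

lemma C_infinity_torus_extend: "open W \<Longrightarrow> C_infinity (\<lambda>z. torus_extend e i\<^sub>0 z i) W"
  by (cases "i = i\<^sub>0")
    (simp_all add: torus_extend_def C_infinity_const C_infinity_bounded_linear bounded_linear_vec_nth)

lemma norm_torus_extend: "z \<in> carrier torus \<Longrightarrow> norm (torus_extend e i\<^sub>0 z i) = 1"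
  by (simp add: torus_extend_def carrier_torus)

text \<open>The diagonal \<open>torus_extend e i\<^sub>0 z\<close> has the right ratios but
  determinant \<open>c z\<close>. A root of order \<open>CARD('n)\<close> of 1 / c z repairs this
  and cancels in the ratios. Such a root is continuous only locally: at the base point it is
  \<open>w\<^sub>0\<close>, and \<open>Ln\<close> continues it as long as \<open>q z\<close>, the
  quotient of \<open>c z\<close> by its value there, has positive real part.\<close>

lemma torus_local_section:
  fixes e :: "'m::finite \<Rightarrow> 'n::finite"
  assumes e: "bij_betw e UNIV (UNIV - {i\<^sub>0})" and z0: "z\<^sub>0 \<in> carrier torus"
  shows "\<exists>W (F :: complex^'m \<Rightarrow> complex^'n^'n). open W \<and> z\<^sub>0 \<in> W \<and> C_infinity F W \<and>
    (\<forall>z\<in>carrier torus \<inter> W. F z \<in> SU_diagonal \<and> torus_coords e i\<^sub>0 (PSU_proj (F z)) = z)"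
proof -
  define c where "c z = (\<Prod>i\<in>UNIV. torus_extend e i\<^sub>0 z i)" for z
  have norm_c: "norm (c z) = 1" if "z \<in> carrier torus" for z
    using that by (simp add: c_def prod_norm[symmetric] norm_torus_extend)
  have c0: "c z\<^sub>0 * cnj (c z\<^sub>0) = 1"
    using norm_c[OF z0] mult_cnj_eq_1_iff by blast
  obtain w\<^sub>0 where w0: "w\<^sub>0 ^ CARD('n) = cnj (c z\<^sub>0)"
    using nth_root_exists[of "CARD('n)" "cnj (c z\<^sub>0)"] by auto
  define q where "q z = c z * cnj (c z\<^sub>0)" for z
  define W where "W = {z. 0 < Re (q z)}"
  define w where "w z = w\<^sub>0 * exp ((- 1 / of_nat CARD('n)) * Ln (q z))" for z
  define F :: "complex^'m \<Rightarrow> complex^'n^'n" where "F z = diag_matrix (\<lambda>i. w z * torus_extend e i\<^sub>0 z i)" for z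
  have q_smooth: "C_infinity q V" if "open V" for V
    unfolding q_def[abs_def] c_def
    by (intro C_infinity_mult C_infinity_prod C_infinity_torus_extend C_infinity_const that)
  have W: "open W"
    unfolding W_def using C_infinity_imp_continuous_on[OF q_smooth[OF open_UNIV]]
    by (intro open_Collect_less continuous_intros)
  have "q z\<^sub>0 = 1"
    by (simp only: q_def c0)
  then have "z\<^sub>0 \<in> W"
    by (simp add: W_def)
  moreover have "C_infinity (\<lambda>z. Ln (q z)) W"
    by (rule C_infinity_Ln[OF W _ q_smooth[OF W]]) (simp add: W_def)
  then have "C_infinity F W"
    unfolding F_def[abs_def] w_def
    by (intro C_infinity_diag_matrix C_infinity_mult C_infinity_torus_extend C_infinity_const C_infinity_exp W)
  moreover have w: "w z ^ CARD('n) * c z = 1" if "z \<in> W" for z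
  proof -
    have "q z \<noteq> 0"
      using that by (auto simp: W_def)
    have "exp ((- 1 / of_nat CARD('n)) * Ln (q z)) ^ CARD('n)
        = exp (of_nat CARD('n) * ((- 1 / of_nat CARD('n)) * Ln (q z)))"
      by (rule exp_of_nat_mult[symmetric])
    also have "of_nat CARD('n) * ((- 1 / of_nat CARD('n)) * Ln (q z)) = - Ln (q z)"
      by simp
    also have "exp (- Ln (q z)) = 1 / q z"
      using \<open>q z \<noteq> 0\<close> by (simp add: exp_minus inverse_eq_divide)
    finally have "exp ((- 1 / of_nat CARD('n)) * Ln (q z)) ^ CARD('n) = 1 / q z" .
    then have "w z ^ CARD('n) * c z = q z * (1 / q z)"
      by (simp add: w_def power_mult_distrib w0 q_def)
    then show ?thesis
      using \<open>q z \<noteq> 0\<close> by simp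
  qed
  have norm_w: "norm (w z) = 1" if "z \<in> carrier torus" "z \<in> W" for z
  proof -
    have "norm (w z) ^ CARD('n) * norm (c z) = 1"
      using arg_cong[OF w[OF that(2)], of norm] by (simp only: norm_mult norm_power norm_one)
    then show ?thesis
      using norm_c[OF that(1)] power_eq_1_iff[of "norm (w z)" "CARD('n)"] by simp
  qed
  have F: "F z \<in> SU_diagonal" if "z \<in> carrier torus" "z \<in> W" for z
    unfolding F_def
    by (rule diag_matrix_in_SU_diagonal)
      (use that w in \<open>simp_all add: norm_mult norm_w norm_torus_extend prod.distrib c_def\<close>)
  moreover have "torus_coords e i\<^sub>0 (PSU_proj (F z)) = z" if "z \<in> carrier torus" "z \<in> W" for z
  proof -
    have "torus_extend e i\<^sub>0 z (e m) = z $ m" for m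
      using bij_betwE[OF e] bij_betw_imp_inj_on[OF e] by (auto simp: torus_extend_def)
    moreover have "torus_extend e i\<^sub>0 z i\<^sub>0 = 1"
      by (simp add: torus_extend_def)
    moreover have "w z * x * cnj (w z) = x" for x
      using norm_w[OF that] mult_cnj_eq_1_iff[of "w z"] by (metis mult.assoc mult.commute mult_1)
    moreover have "PSU_ratio (PSU_proj (F z)) $ i $ j
        = (w z * torus_extend e i\<^sub>0 z i) * cnj (w z * torus_extend e i\<^sub>0 z j)" for i j
      unfolding F_def by (rule PSU_ratio_diag) (use F[OF that] in \<open>simp add: F_def\<close>)
    ultimately show ?thesis
      by (simp add: torus_coords_def vec_eq_iff)
  qed
  ultimately show ?thesis
    using W by blast
qed

text \<open>Every ratio is a quotient of two ratios to the entry at \<open>i\<^sub>0\<close>, so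
  these determine the whole of \<open>PSU_ratio\<close>.\<close>

lemma inj_on_torus_coords:
  fixes e :: "'m::finite \<Rightarrow> 'n::finite"
  assumes e: "bij_betw e UNIV (UNIV - {i\<^sub>0})"
  shows "inj_on (torus_coords e i\<^sub>0) (PSU_diagonal :: (complex^'n^'n) set set)"
proof (rule inj_onI)
  fix p q :: "(complex^'n^'n) set"
  assume p: "p \<in> PSU_diagonal" and q: "q \<in> PSU_diagonal" and eq: "torus_coords e i\<^sub>0 p = torus_coords e i\<^sub>0 q"
  have ratio: "PSU_ratio r $ i\<^sub>0 $ i\<^sub>0 = 1"
    "PSU_ratio r $ i $ j = PSU_ratio r $ i $ i\<^sub>0 * cnj (PSU_ratio r $ j $ i\<^sub>0)"
    if r: "r \<in> PSU_diagonal" for r :: "(complex^'n^'n) set" and i j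
  proof -
    obtain a where a: "r = PSU_proj (diag_matrix a)" "diag_matrix a \<in> SU_diagonal" "\<And>i. norm (a i) = 1"
      using PSU_diagonalE[OF r] by blast
    have a0: "a i\<^sub>0 * cnj (a i\<^sub>0) = 1"
      using a(3) mult_cnj_eq_1_iff by blast
    then show "PSU_ratio r $ i\<^sub>0 $ i\<^sub>0 = 1"
      by (simp only: a(1) PSU_ratio_diag[OF a(2)])
    have "a i * cnj (a j) = (a i\<^sub>0 * cnj (a i\<^sub>0)) * (a i * cnj (a j))"
      by (simp only: a0 mult_1)
    then show "PSU_ratio r $ i $ j = PSU_ratio r $ i $ i\<^sub>0 * cnj (PSU_ratio r $ j $ i\<^sub>0)"
      by (simp only: a(1) PSU_ratio_diag[OF a(2)]) (simp add: mult_ac)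
  qed
  have "PSU_ratio p $ i $ i\<^sub>0 = PSU_ratio q $ i $ i\<^sub>0" for i
  proof (cases "i = i\<^sub>0")
    case True
    then show ?thesis using ratio(1) p q by simp
  next
    case False
    then obtain m where "i = e m"
      using e by (auto simp: bij_betw_def)
    then show ?thesis
      using eq by (simp add: torus_coords_def vec_eq_iff)
  qed
  then have "PSU_ratio p $ i $ j = PSU_ratio q $ i $ j" for i j
    using ratio(2)[OF p, of i j] ratio(2)[OF q, of i j] by simp
  then have "PSU_ratio p = PSU_ratio q"
    by (simp add: vec_eq_iff)
  then show "p = q"
    by (rule inj_onD[OF inj_on_PSU_ratio _ p q])
qed

lemma torus_coords_in_torus:
  assumes "p \<in> PSU_diagonal"
  shows "torus_coords e i\<^sub>0 p \<in> carrier torus"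
proof -
  obtain a where a: "p = PSU_proj (diag_matrix a)" "diag_matrix a \<in> SU_diagonal" "\<And>i. norm (a i) = 1"
    using PSU_diagonalE[OF assms] by blast
  then show ?thesis
    by (simp add: carrier_torus torus_coords_def PSU_ratio_diag norm_mult)
qed

lemma Lie_isomorphism_torus_coords:
  fixes e :: "'m::finite \<Rightarrow> 'n::finite"
  assumes e: "bij_betw e UNIV (UNIV - {i\<^sub>0})"
  shows "Lie_isomorphism_to_torus (PSU_diagonal :: (complex^'n^'n) set set) (torus_coords e i\<^sub>0)"
  unfolding Lie_isomorphism_to_torus_def
proof (intro conjI)
  let ?\<phi> = "torus_coords e i\<^sub>0 :: (complex^'n^'n) set \<Rightarrow> complex^'m"
  have "z \<in> ?\<phi> ` PSU_diagonal" if z: "z \<in> carrier torus" for z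
  proof -
    obtain A :: "complex^'n^'n" where "A \<in> SU_diagonal" "?\<phi> (PSU_proj A) = z"
      using torus_local_section[OF e z] z by blast
    then show ?thesis
      unfolding PSU_diagonal_def by blast
  qed
  then have "bij_betw ?\<phi> PSU_diagonal (carrier torus)"
    unfolding bij_betw_def using inj_on_torus_coords[OF e] torus_coords_in_torus by blast
  moreover have "?\<phi> \<in> hom (PSU\<lparr>carrier := PSU_diagonal\<rparr>) torus"
    by (simp add: hom_def torus_coords_in_torus mult_torus)
      (simp add: torus_coords_def PSU_ratio_mult vec_eq_iff)
  ultimately show "?\<phi> \<in> iso (PSU\<lparr>carrier := PSU_diagonal\<rparr>) torus"
    by (simp add: iso_def)
  show "smooth_from_PSU (PSU_diagonal :: (complex^'n^'n) set set) ?\<phi>"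
    unfolding smooth_from_PSU_def smooth_map_on_def
  proof (intro ballI exI conjI)
    \<comment> \<open>Being polynomial in the entries and their conjugates, the coordinates extend
      smoothly to all matrices at once.\<close>
    show "C_infinity (\<lambda>A :: complex^'n^'n. \<chi> m. A $ e m $ e m * cnj (A $ i\<^sub>0 $ i\<^sub>0)) UNIV"
      by (intro C_infinity_vec C_infinity_mult C_infinity_cnj open_UNIV C_infinity_bounded_linear
          bounded_linear_compose[OF bounded_linear_vec_nth bounded_linear_vec_nth])
  qed (auto simp: torus_coords_def PSU_ratio_proj)
  show "smooth_into_PSU (carrier torus) (inv_into (PSU_diagonal :: (complex^'n^'n) set set) ?\<phi>)"
    unfolding smooth_into_PSU_def
  proof
    fix z\<^sub>0 :: "complex^'m" assume z0: "z\<^sub>0 \<in> carrier torus"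
    obtain W and F :: "complex^'m \<Rightarrow> complex^'n^'n" where WF: "open W" "z\<^sub>0 \<in> W" "C_infinity F W"
      "\<forall>z\<in>carrier torus \<inter> W. F z \<in> SU_diagonal \<and> ?\<phi> (PSU_proj (F z)) = z"
      using torus_local_section[OF e z0] by blast
    have "F z \<in> carrier SU \<and> inv_into PSU_diagonal ?\<phi> z = PSU_proj (F z)"
      if z: "z \<in> carrier torus \<inter> W" for z
    proof
      have F: "F z \<in> SU_diagonal" "?\<phi> (PSU_proj (F z)) = z"
        using WF(4) z by blast+
      show "F z \<in> carrier SU"
        using F(1) SU_diagonal_subset by blast
      show "inv_into PSU_diagonal ?\<phi> z = PSU_proj (F z)"
        by (rule inv_into_f_eq[OF inj_on_torus_coords[OF e] _ F(2)]) (use F(1) in \<open>simp add: PSU_diagonal_def\<close>)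
    qed
    then have "smooth_lift_at (carrier torus) (inv_into PSU_diagonal ?\<phi>) z\<^sub>0 F"
      unfolding smooth_lift_at_def using WF(1-3) by blast
    then show "\<exists>F. smooth_lift_at (carrier torus) (inv_into PSU_diagonal ?\<phi>) z\<^sub>0 F"
      by blast
  qed
qed

section \<open>Connected Abelian subgroups\<close>

text \<open>Different local lifts need not agree, but their projections all equal \<psi>, so the
  continuous pieces can be pasted.\<close>

lemma continuous_map_smooth_into_PSU:
  fixes \<psi> :: "'a::real_normed_vector \<Rightarrow> (complex^'n^'n) set"
  assumes "\<And>x. x \<in> U \<Longrightarrow> \<exists>F. smooth_lift_at U \<psi> x F"
  shows "continuous_map (top_of_set U) PSU_topology \<psi>"
proof -
  obtain F where "\<And>x. x \<in> U \<Longrightarrow> smooth_lift_at U \<psi> x (F x)"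
    using assms by metis
  then obtain W where W: "\<And>x. x \<in> U \<Longrightarrow> open (W x) \<and> x \<in> W x \<and> C_infinity (F x) (W x) \<and>
      (\<forall>y\<in>U \<inter> W x. F x y \<in> carrier SU \<and> \<psi> y = PSU_proj (F x y))"
    unfolding smooth_lift_at_def by metis
  show ?thesis
  proof (rule pasting_lemma[where I = U and T = "\<lambda>x. U \<inter> W x" and f = "\<lambda>x y. PSU_proj (F x y)"])
    fix x assume x: "x \<in> U"
    show "openin (top_of_set U) (U \<inter> W x)"
      using W[OF x] by (simp add: openin_open_Int)
    have "continuous_map (top_of_set (U \<inter> W x)) PSU_topology (\<lambda>y. PSU_proj (F x y))"
    proof (rule continuous_map_PSU_proj_comp)
      have "continuous_on (W x) (F x)"
        using W[OF x] C_infinity_imp_continuous_on by blast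
      then show "continuous_on (U \<inter> W x) (F x)"
        by (rule continuous_on_subset) simp
      show "F x ` (U \<inter> W x) \<subseteq> carrier SU"
        using W[OF x] by blast
    qed
    then show "continuous_map (subtopology (top_of_set U) (U \<inter> W x)) PSU_topology (\<lambda>y. PSU_proj (F x y))"
      by (simp add: subtopology_subtopology inf.absorb2)
  next
    fix i j y assume ij: "i \<in> U" "j \<in> U" and y: "y \<in> topspace (top_of_set U) \<inter> (U \<inter> W i) \<inter> (U \<inter> W j)"
    from y have "y \<in> U \<inter> W i" "y \<in> U \<inter> W j"
      by auto
    then have "\<psi> y = PSU_proj (F i y)" "\<psi> y = PSU_proj (F j y)"
      using W[OF ij(1)] W[OF ij(2)] by blast+
    then show "PSU_proj (F i y) = PSU_proj (F j y)"
      by simp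
  next
    fix y assume "y \<in> topspace (top_of_set U)"
    then show "\<exists>j. j \<in> U \<and> y \<in> U \<inter> W j \<and> \<psi> y = PSU_proj (F j y)"
      using W[of y] by (intro exI[of _ y]) auto
  qed
qed

text \<open>On the image of a chart the inclusion into \<open>PSU\<close> is \<psi> after its
  inverse, hence continuous for \<open>T\<close>. Pasting over the open chart images makes the whole
  inclusion continuous, and it carries connectedness along.\<close>

lemma connectedin_Lie_subgroup:
  fixes H :: "(complex^'n^'n) set set"
  assumes "Lie_subgroup H T" "connected_space T"
  shows "connectedin PSU_topology H"
proof -
  from assms(1) obtain V P where T: "topspace T = H" and P: "immersed_submanifold T V P"
    unfolding Lie_subgroup_def by blast
  have cover: "topspace T = (\<Union>(U, \<psi>)\<in>P. \<psi> ` U)"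
    using P unfolding immersed_submanifold_def by blast
  have chart: "openin T (\<psi> ` U)" "homeomorphic_map (top_of_set U) (subtopology T (\<psi> ` U)) \<psi>"
    "immersion_into_PSU V U \<psi>" if "(U, \<psi>) \<in> P" for U \<psi>
    using P that unfolding immersed_submanifold_def by auto
  have "continuous_map T PSU_topology (\<lambda>p. p)"
  proof (rule pasting_lemma[where I = P and T = "\<lambda>(U, \<psi>). \<psi> ` U" and f = "\<lambda>_ p. p"])
    fix i assume "i \<in> P"
    obtain U \<psi> where i: "i = (U, \<psi>)" by (cases i)
    note chart = chart[of U \<psi>, OF \<open>i \<in> P\<close>[unfolded i]]
    show "openin T (case i of (U, \<psi>) \<Rightarrow> \<psi> ` U)"
      using chart(1) by (simp add: i)
    obtain g where g: "homeomorphic_maps (top_of_set U) (subtopology T (\<psi> ` U)) \<psi> g"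
      using chart(2) homeomorphic_map_maps by blast
    have "continuous_map (top_of_set U) PSU_topology \<psi>"
      using chart(3) unfolding immersion_into_PSU_def
      by (intro continuous_map_smooth_into_PSU) blast
    moreover have "continuous_map (subtopology T (\<psi> ` U)) (top_of_set U) g"
      using g by (simp add: homeomorphic_maps_def)
    ultimately have "continuous_map (subtopology T (\<psi> ` U)) PSU_topology (\<psi> \<circ> g)"
      by (rule continuous_map_compose[rotated])
    then have "continuous_map (subtopology T (\<psi> ` U)) PSU_topology (\<lambda>p. p)"
      by (rule continuous_map_eq) (use g in \<open>simp add: homeomorphic_maps_def\<close>)
    then show "continuous_map (subtopology T (case i of (U, \<psi>) \<Rightarrow> \<psi> ` U)) PSU_topology (\<lambda>p. p)"
      by (simp add: i)
  qed (use cover in auto)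
  from connectedin_continuous_map_image[OF this, of H] show ?thesis
    using assms(2) T connectedin_topspace[of T] by simp
qed

text \<open>Adjoints stand for inverses. Scalars are central, so the choice of the lift has no
  effect, and for fixed \<open>B\<close> this is a continuous function on
  \<open>PSU\<close>.\<close>

definition PSU_commutator :: "complex^'n^'n \<Rightarrow> (complex^'n^'n) set \<Rightarrow> complex^'n^'n" where
  "PSU_commutator B p = PSU_lift p ** B ** adjoint_matrix (PSU_lift p) ** adjoint_matrix B"

lemma PSU_commutator_proj:
  fixes A B :: "complex^'n^'n"
  assumes "A \<in> carrier SU"
  shows "PSU_commutator B (PSU_proj A) = A ** B ** adjoint_matrix A ** adjoint_matrix B"
proof -
  obtain \<zeta> where \<zeta>: "norm \<zeta> = 1" "PSU_lift (PSU_proj A) = mat \<zeta> ** A"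
    by (rule PSU_lift_scalar[OF assms])
  have "mat \<zeta> ** A ** B ** (adjoint_matrix A ** mat (cnj \<zeta>)) ** adjoint_matrix B
      = mat \<zeta> ** (A ** B ** adjoint_matrix A ** mat (cnj \<zeta>)) ** adjoint_matrix B"
    by (simp only: matrix_mul_assoc)
  also have "\<dots> = mat \<zeta> ** mat (cnj \<zeta>) ** (A ** B ** adjoint_matrix A ** adjoint_matrix B)"
    by (simp only: mat_mult_commute[of "cnj \<zeta>", symmetric] matrix_mul_assoc)
  finally have "mat \<zeta> ** A ** B ** (adjoint_matrix A ** mat (cnj \<zeta>)) ** adjoint_matrix B
      = mat \<zeta> ** mat (cnj \<zeta>) ** (A ** B ** adjoint_matrix A ** adjoint_matrix B)" .
  moreover have "mat \<zeta> ** mat (cnj \<zeta>) = (mat 1 :: complex^'n^'n)"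
    using \<zeta>(1) mult_cnj_eq_1_iff[of \<zeta>] by (simp add: mat_eq_diag_matrix diag_matrix_mult)
  moreover have "adjoint_matrix (mat \<zeta> ** A) = adjoint_matrix A ** mat (cnj \<zeta>)"
    by (simp add: adjoint_matrix_mult mat_eq_diag_matrix adjoint_diag_matrix)
  ultimately show ?thesis
    by (simp add: PSU_commutator_def \<zeta>(2))
qed

lemma continuous_on_matrix_mult:
  fixes f g :: "'a::topological_space \<Rightarrow> complex^'n^'n"
  assumes "continuous_on S f" "continuous_on S g"
  shows "continuous_on S (\<lambda>x. f x ** g x)"
  unfolding matrix_matrix_mult_def by (intro continuous_intros assms)

lemma continuous_map_PSU_commutator: "continuous_map PSU_topology euclidean (PSU_commutator B)"
proof (rule continuous_map_from_PSU)
  have "continuous_on (carrier SU) (\<lambda>A. A ** B ** adjoint_matrix A ** adjoint_matrix B)"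
    unfolding adjoint_matrix_def by (intro continuous_on_matrix_mult continuous_intros)
  then have "continuous_map (top_of_set (carrier SU)) euclidean (\<lambda>A. A ** B ** adjoint_matrix A ** adjoint_matrix B)"
    by simp
  then show "continuous_map (top_of_set (carrier SU)) euclidean (\<lambda>A. PSU_commutator B (PSU_proj A))"
    by (rule continuous_map_eq) (simp add: PSU_commutator_proj)
qed

lemma finite_SU_scalars: "finite (SU_scalars :: (complex^'n^'n) set)"
proof -
  have eq: "SU_scalars = (mat :: complex \<Rightarrow> complex^'n^'n) ` {\<zeta>. \<zeta> ^ CARD('n) = 1}"
    by (auto simp: SU_scalars_def)
  show ?thesis
    unfolding eq by (intro finite_imageI finite_roots_unity) simp
qed

text \<open>Lifts of commuting elements commute up to a scalar. The scalar is constant along a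
  connected group, because the possible values form a finite set.\<close>

lemma lifts_commute:
  fixes H :: "(complex^'n^'n) set set"
  assumes H: "abelian_subgroup H" "connectedin PSU_topology H"
    and A: "A \<in> carrier SU" "PSU_proj A \<in> H" and B: "B \<in> carrier SU" "PSU_proj B \<in> H"
  shows "A ** B = B ** A"
proof -
  have "PSU_commutator B ` H \<subseteq> SU_scalars"
  proof
    fix C assume "C \<in> PSU_commutator B ` H"
    then obtain p where p: "p \<in> H" "C = PSU_commutator B p" by blast
    then have "p \<in> carrier PSU"
      using H(1) subgroup.subset unfolding abelian_subgroup_def by blast
    then obtain D where D: "D \<in> carrier SU" "p = PSU_proj D"
      by (auto simp: carrier_PSU)
    have "PSU_proj D \<otimes>\<^bsub>PSU\<^esub> PSU_proj B = PSU_proj B \<otimes>\<^bsub>PSU\<^esub> PSU_proj D"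
      using H(1) p(1) B(2) unfolding abelian_subgroup_iff D(2) by blast
    then have "PSU_proj (D ** B) = PSU_proj (B ** D)"
      by (simp only: PSU_proj_mult[OF D(1) B(1)] PSU_proj_mult[OF B(1) D(1)])
    then obtain \<zeta> where \<zeta>: "\<zeta> ^ CARD('n) = 1" "D ** B = mat \<zeta> ** (B ** D)"
      using PSU_proj_eq_iff[OF SU_mult_closed[OF D(1) B(1)] SU_mult_closed[OF B(1) D(1)]] by blast
    \<comment> \<open>With D B = \<zeta> B D the commutator telescopes to the scalar.\<close>
    have "C = mat \<zeta> ** (B ** (D ** adjoint_matrix D) ** adjoint_matrix B)"
      unfolding p(2) D(2) PSU_commutator_proj[OF D(1)] \<zeta>(2) by (simp only: matrix_mul_assoc)
    then have "C = mat \<zeta>"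
      by (simp add: SU_adjoint_mult D(1) B(1))
    then show "C \<in> SU_scalars"
      using \<zeta>(1) by (auto simp: SU_scalars_def)
  qed
  then have fin: "finite (PSU_commutator B ` H)"
    using finite_SU_scalars finite_subset by blast
  have "connectedin euclidean (PSU_commutator B ` H)"
    using connectedin_continuous_map_image[OF continuous_map_PSU_commutator H(2)] .
  then have "connected (PSU_commutator B ` H)"
    by simp
  then obtain C where C: "PSU_commutator B ` H \<subseteq> {C}"
    using connected_finite_iff_sing[of "PSU_commutator B ` H"] fin by auto
  have "\<one>\<^bsub>PSU\<^esub> \<in> H"
    using H(1) by (simp add: abelian_subgroup_def subgroup.one_closed)
  moreover have "\<one>\<^bsub>PSU\<^esub> = PSU_proj (mat 1 :: complex^'n^'n)"
    by (simp add: PSU_def PSU_proj_def group.coset_mult_one[OF group_SU subgroup.subset[OF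
            normal_imp_subgroup[OF normal_SU_scalars]], unfolded one_SU])
  ultimately have "PSU_proj (mat 1) \<in> H"
    by simp
  then have "PSU_commutator B (PSU_proj A) = PSU_commutator B (PSU_proj (mat 1))"
    using C A(2) by blast
  then have "A ** B ** adjoint_matrix A ** adjoint_matrix B = mat 1"
    by (simp add: PSU_commutator_proj A(1) mat_1_in_SU SU_adjoint_mult B(1))
  \<comment> \<open>Right multiplication by \<open>B ** A\<close> undoes the two adjoints and leaves
    \<open>A ** B\<close> on the left-hand side.\<close>
  moreover have "A ** B ** (adjoint_matrix A ** (adjoint_matrix B ** B) ** A)
      = A ** B ** adjoint_matrix A ** adjoint_matrix B ** (B ** A)"
    by (simp only: matrix_mul_assoc)
  ultimately show ?thesis
    by (simp add: SU_adjoint_mult A(1) B(1))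
qed

text \<open>A matrix that diagonalises all lifts of elements of \<open>H\<close> at once projects to
  the conjugating element.\<close>

lemma conjugate_into_PSU_diagonal:
  fixes H :: "(complex^'n^'n) set set"
  assumes H: "abelian_subgroup H" "connectedin PSU_topology H"
  shows "\<exists>g\<in>carrier PSU. (\<lambda>h. g \<otimes>\<^bsub>PSU\<^esub> h \<otimes>\<^bsub>PSU\<^esub> inv\<^bsub>PSU\<^esub> g) ` H \<subseteq> PSU_diagonal"
proof -
  define S where "S = {A \<in> carrier SU. PSU_proj A \<in> H}"
  have "A ** B = B ** A" if "A \<in> S" "B \<in> S" for A B
    using lifts_commute[OF H] that unfolding S_def by blast
  then obtain Q where Q: "Q \<in> carrier SU" "\<And>A. A \<in> S \<Longrightarrow> Q ** A ** adjoint_matrix Q \<in> SU_diagonal"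
    using simultaneously_diagonalisable[of S] unfolding S_def by blast
  have "PSU_proj Q \<otimes>\<^bsub>PSU\<^esub> h \<otimes>\<^bsub>PSU\<^esub> inv\<^bsub>PSU\<^esub> PSU_proj Q \<in> PSU_diagonal" if h: "h \<in> H" for h
  proof -
    have "h \<in> carrier PSU"
      using h H(1) subgroup.subset unfolding abelian_subgroup_def by blast
    then obtain A where A: "A \<in> carrier SU" "h = PSU_proj A"
      by (auto simp: carrier_PSU)
    then have "Q ** A ** adjoint_matrix Q \<in> SU_diagonal"
      using Q(2) h by (simp add: S_def)
    moreover have "PSU_proj Q \<otimes>\<^bsub>PSU\<^esub> h \<otimes>\<^bsub>PSU\<^esub> inv\<^bsub>PSU\<^esub> PSU_proj Q = PSU_proj (Q ** A ** adjoint_matrix Q)"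
      by (simp add: A PSU_proj_inv PSU_proj_mult SU_mult_closed SU_adjoint_closed Q(1))
    ultimately show ?thesis
      by (simp add: PSU_diagonal_def)
  qed
  then show ?thesis
    using PSU_proj_in_PSU[OF Q(1)] by blast
qed

theorem theorem6p2:
  fixes n :: nat
  assumes "n \<ge> 1" and "CARD('n::finite) = n + 1" and "CARD('m::finite) = n"
  shows "Lie_subgroup (PSU_diagonal :: (complex^'n^'n) set set)
           (subtopology PSU_topology PSU_diagonal)
    \<and> (\<exists>\<phi> :: (complex^'n^'n) set \<Rightarrow> complex^'m. Lie_isomorphism_to_torus PSU_diagonal \<phi>)
    \<and> (abelian_subgroup (PSU_diagonal :: (complex^'n^'n) set set) \<and>
       (\<forall>H :: (complex^'n^'n) set set.
          abelian_subgroup H \<and> connectedin PSU_topology H \<and> H \<noteq> carrier PSU \<and>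
          PSU_diagonal \<subseteq> H \<longrightarrow> H = PSU_diagonal))
    \<and> (\<forall>(H :: (complex^'n^'n) set set) T.
          Lie_subgroup H T \<and> connected_space T \<and> abelian_subgroup H \<longrightarrow>
          (\<exists>g \<in> carrier PSU. (\<lambda>h. g \<otimes>\<^bsub>PSU\<^esub> h \<otimes>\<^bsub>PSU\<^esub> inv\<^bsub>PSU\<^esub> g) ` H \<subseteq> PSU_diagonal))"
proof (intro conjI allI impI)
  show "Lie_subgroup (PSU_diagonal :: (complex^'n^'n) set set) (subtopology PSU_topology PSU_diagonal)"
    by (rule Lie_subgroup_PSU_diagonal)
  obtain i\<^sub>0 :: 'n where True by simp
  have "card (UNIV - {i\<^sub>0}) = CARD('m)"
    using assms(2,3) by simp
  \<comment> \<open>\<open>e\<close> enumerates the indices other than \<open>i\<^sub>0\<close>;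
    this is how matrices of size \<open>n + 1\<close> lead to a torus of dimension
    \<open>n\<close>.\<close>
  then obtain e :: "'m \<Rightarrow> 'n" where "bij_betw e UNIV (UNIV - {i\<^sub>0})"
    using bij_betw_iff_card[of "UNIV :: 'm set" "UNIV - {i\<^sub>0}"] by auto
  then show "\<exists>\<phi> :: (complex^'n^'n) set \<Rightarrow> complex^'m. Lie_isomorphism_to_torus PSU_diagonal \<phi>"
    using Lie_isomorphism_torus_coords by blast
  show "abelian_subgroup (PSU_diagonal :: (complex^'n^'n) set set)"
    by (rule abelian_subgroup_PSU_diagonal)
next
  fix H :: "(complex^'n^'n) set set"
  assume "abelian_subgroup H \<and> connectedin PSU_topology H \<and> H \<noteq> carrier PSU \<and> PSU_diagonal \<subseteq> H"
  then show "H = PSU_diagonal"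
    using PSU_diagonal_self_centralising by blast
next
  fix H :: "(complex^'n^'n) set set" and T
  assume "Lie_subgroup H T \<and> connected_space T \<and> abelian_subgroup H"
  then show "\<exists>g\<in>carrier PSU. (\<lambda>h. g \<otimes>\<^bsub>PSU\<^esub> h \<otimes>\<^bsub>PSU\<^esub> inv\<^bsub>PSU\<^esub> g) ` H \<subseteq> PSU_diagonal"
    using conjugate_into_PSU_diagonal connectedin_Lie_subgroup by blast
qed

end
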